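(* Let $(\bar{a}^*, \bar{d}^*, \bar{e}^*, \bar{f}^*, u^*, q^* )$ be an optimal solution to the conic problem $\mathsf{CP}_3$. For each $(i,j)\in\mathcal{IJ}$ and $1\le k\le K_i$, let $$x_{ijk}^* = \begin{cases} u_{ijk}^*/\bar d_{ijk}^* & \text{if } \bar d_{ijk}^*>0,\\ 0 & \text{otherwise,}\end{cases}\qquad p_{ijk}^* = \frac{\exp(\alpha_{ijk}-\beta_{ij}x_{ijk}^* )}{1+\exp(\alpha_{ijk}-\beta_{ij}x_{ijk}^* )}.$$ Then $(\bar{a}^*, \bar{d}^*, \bar{e}^*, \bar{f}^*, x^*, p^*, q^* )$ is an optimal solution to the problem $\mathsf{FP}_3$.
   Context: **Data.** $\mathcal{I}$ is a finite set of zones. For each $i\in\mathcal{I}$, $\mathcal{I}_i\subseteq\mathcal{I}$ and $\widetilde{\mathcal{I}}_i\subseteq\mathcal{I}$ are the sets of destinations reachable from $i$ with, respectively without, a passenger (here $\widetilde{\mathcal{I}}_i$ is interpreted as the set of zones adjacent to $i$). Put $\mathcal{IJ}=\{(i,j): i\in\mathcal{I}, j\in\mathcal{I}_i\}$, $\widetilde{\mathcal{IJ}}=\{(i,j): i\in\mathcal{I}, j\in\widetilde{\mathcal{I}}_i\}$, $\mathcal{J}_i=\{j\in\mathcal{I}:(j,i)\in\mathcal{IJ}\}$, $\widetilde{\mathcal{J}}_i=\{j\in\mathcal{I}:(j,i)\in\widetilde{\mathcal{IJ}}\}$. Assume $\mathcal{IJ}\ne\varnothing$ and that the directed graph $(\mathcal{I},\widetilde{\mathcal{IJ}})$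 is strongly connected. For each $i\in\mathcal{I}$, $K_i\ge1$ is an integer, and $K_0=\max_i K_i$. Parameters: $\omega>0$; $\sigma_i>0$ for $i\in\mathcal{I}$; $\mu_{ij}>0$, $\lambda_{ij}>0$, $\beta_{ij}>0$ for $(i,j)\in\mathcal{IJ}$; $\widetilde\mu_{ij}>0$ and constants $\zeta_{ij}\in[0,1]$ for $(i,j)\in\widetilde{\mathcal{IJ}}$; $0<1/\nu_1<\cdots<1/\nu_{K_0}$; $0=\delta_0<\delta_1<\cdots<\delta_{K_0}$; reals $\alpha_{ij1}>\cdots>\alpha_{ijK_i}$ and costs $\phi_{ij1}\le\cdots\le\phi_{ijK_i}$ for $(i,j)\in\mathcal{IJ}$; costs $\psi_{ij}$ for $(i,j)\in\widetilde{\mathcal{IJ}}$. **Variables.** Real vectors $\bar a=(\bar a_i)_{i\in\mathcal{I}}$; $\bar d=(\bar d_{ijk})$, $x=(x_{ijk})$, $p=(p_{ijk})$, $u=(u_{ijk})$ indexed by $(i,j)\in\mathcal{IJ}$, $1\le k\le K_i$; $\bar e=(\bar e_{ij})_{(i,j)\in\widetilde{\mathcal{IJ}}}$; $\bar f=(\bar f_{ij})_{(i,j)\in\mathcal{IJ}}$; $q=(q_{ik})_{i\in\mathcal{I},1\le k\le K_i}$. **Exponential cone.** $\mathcal{K}_{\exp}=\{(a_1,a_2,a_3): a_3\le a_2\log(a_1/a_2), a_1>0,a_2>0\}\cup\{(a_1,0,a_3): a_1\ge0,a_3\le0\}$. **Common linear constraints (L):** - $\sum_{k=1}^{K_i}\nu_k\bar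 d_{ijk}=\mu_{ij}\bar f_{ij}$ for $(i,j)\in\mathcal{IJ}$; - $\sum_{j\in\widetilde{\mathcal{J}}_i}\widetilde\mu_{ji}\bar e_{ji}+\sum_{j\in\mathcal{J}_i}\mu_{ji}\bar f_{ji}=\sum_{j\in\widetilde{\mathcal{I}}_i}\widetilde\mu_{ij}\bar e_{ij}+\sum_{j\in\mathcal{I}_i}\mu_{ij}\bar f_{ij}$ for $i\in\mathcal{I}$; - $\sum_{i\in\mathcal{I}}\big(\bar a_i+\sum_{j\in\widetilde{\mathcal{I}}_i}\bar e_{ij}+\sum_{j\in\mathcal{I}_i}(\bar f_{ij}+\sum_{k=1}^{K_i}\bar d_{ijk})\big)=1$; - $\bar a,\bar d,\bar e,\bar f\ge0$. **Problem $\mathsf{FP}_3$.** Over $(\bar a,\bar d,\bar e,\bar f,x,p,q)$, maximize $$\sum_{(i,j)\in\mathcal{IJ}}\sum_{k=1}^{K_i}\nu_k\bar d_{ijk}(x_{ijk}-\phi_{ijk})-\sum_{(i,j)\in\widetilde{\mathcal{IJ}}}\psi_{ij}\widetilde\mu_{ij}\bar e_{ij}$$ subject to (L) and - $\sum_{k'=1}^k q_{ik'}=1-\exp\big(-\omega\delta_k^2(\bar a_i+\sum_{j\in\widetilde{\mathcal{J}}_i}\zeta_{ji}\bar e_{ji})/\sigma_i\big)$ for $i\in\mathcal{I}$, $1\le k\le K_i$; - $p_{ijk}=\frac{\exp(\alpha_{ijk}-\beta_{ij}x_{ijk})}{1+\exp(\alpha_{ijk}-\beta_{ij}x_{ijk})}$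 and $\lambda_{ij}q_{ik}p_{ijk}=\nu_k\bar d_{ijk}$ for $(i,j)\in\mathcal{IJ}$, $1\le k\le K_i$. **Problem $\mathsf{CP}_3$.** Over $(\bar a,\bar d,\bar e,\bar f,u,q)$, maximize $$\sum_{(i,j)\in\mathcal{IJ}}\sum_{k=1}^{K_i}(\nu_k u_{ijk}-\nu_k\phi_{ijk}\bar d_{ijk})-\sum_{(i,j)\in\widetilde{\mathcal{IJ}}}\psi_{ij}\widetilde\mu_{ij}\bar e_{ij}$$ subject to (L), $q\ge0$, and - $\big(1-\sum_{k'=1}^k q_{ik'},\,1,\,-\omega\delta_k^2(\bar a_i+\sum_{j\in\widetilde{\mathcal{J}}_i}\zeta_{ji}\bar e_{ji})/\sigma_i\big)\in\mathcal{K}_{\exp}$ for $i\in\mathcal{I}$, $1\le k\le K_i$; - $\big(\lambda_{ij}q_{ik}-\nu_k\bar d_{ijk},\,\nu_k\bar d_{ijk},\,\beta_{ij}\nu_k u_{ijk}-\alpha_{ijk}\nu_k\bar d_{ijk}\big)\in\mathcal{K}_{\exp}$ for $(i,j)\in\mathcal{IJ}$, $1\le k\le K_i$.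
   Formalization: For zones i with no passenger destinations (I_i empty), it is additionally assumed that q* satisfies the FP3 equation for the partial sums of q_ik; without this the claim fails, since CP3 only bounds these q from above. Nothing is added when every I_i is nonempty. *)

theory Defs
  imports Complex_Main
begin

text \<open>
  Families indexed by zones and distance classes are total functions; a problem constrains and
  evaluates them only on their index sets, so the values elsewhere are irrelevant.
  The suffix \<open>_e\<close> marks data of empty (passenger-free) trips, written with a tilde on paper.
  The parameter called \<open>lambda\<close> on paper is \<open>net_lam\<close>, and \<open>net_K N i\<close> is \<open>K\<^sub>i\<close>.
\<close>

record 'z network =
  net_zones :: "'z set"
  net_dest :: "'z \<Rightarrow> 'z set"
  net_dest_e :: "'z \<Rightarrow> 'z set"
  net_K :: "'z \<Rightarrow> nat"
  net_omega :: real
  net_sigma :: "'z \<Rightarrow> real"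
  net_mu :: "'z \<Rightarrow> 'z \<Rightarrow> real"
  net_mu_e :: "'z \<Rightarrow> 'z \<Rightarrow> real"
  net_lam :: "'z \<Rightarrow> 'z \<Rightarrow> real"
  net_beta :: "'z \<Rightarrow> 'z \<Rightarrow> real"
  net_zeta :: "'z \<Rightarrow> 'z \<Rightarrow> real"
  net_nu :: "nat \<Rightarrow> real"
  net_delta :: "nat \<Rightarrow> real"
  net_alpha :: "'z \<Rightarrow> 'z \<Rightarrow> nat \<Rightarrow> real"
  net_phi :: "'z \<Rightarrow> 'z \<Rightarrow> nat \<Rightarrow> real"
  net_psi :: "'z \<Rightarrow> 'z \<Rightarrow> real"

definition arcs :: "'z network \<Rightarrow> ('z \<times> 'z) set" where
  "arcs N = {(i, j). i \<in> net_zones N \<and> j \<in> net_dest N i}"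

definition arcs_e :: "'z network \<Rightarrow> ('z \<times> 'z) set" where
  "arcs_e N = {(i, j). i \<in> net_zones N \<and> j \<in> net_dest_e N i}"

definition orig :: "'z network \<Rightarrow> 'z \<Rightarrow> 'z set" where
  "orig N i = {j \<in> net_zones N. (j, i) \<in> arcs N}"

definition orig_e :: "'z network \<Rightarrow> 'z \<Rightarrow> 'z set" where
  "orig_e N i = {j \<in> net_zones N. (j, i) \<in> arcs_e N}"

definition net_K0 :: "'z network \<Rightarrow> nat" where
  "net_K0 N = Max (net_K N ` net_zones N)"

definition valid_network :: "'z network \<Rightarrow> bool" where
  "valid_network N \<longleftrightarrow>
     finite (net_zones N) \<and>
     (\<forall>i\<in>net_zones N. net_dest N i \<subseteq> net_zones N \<and> net_dest_e N i \<subseteq> net_zones N) \<and>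
     arcs N \<noteq> {} \<and>
     (\<forall>i\<in>net_zones N. \<forall>j\<in>net_zones N. (i, j) \<in> (arcs_e N)\<^sup>*) \<and>
     (\<forall>i\<in>net_zones N. net_K N i \<ge> 1) \<and>
     net_omega N > 0 \<and>
     (\<forall>i\<in>net_zones N. net_sigma N i > 0) \<and>
     (\<forall>(i, j)\<in>arcs N. net_mu N i j > 0 \<and> net_lam N i j > 0 \<and> net_beta N i j > 0) \<and>
     (\<forall>(i, j)\<in>arcs_e N. net_mu_e N i j > 0 \<and> 0 \<le> net_zeta N i j \<and> net_zeta N i j \<le> 1) \<and>
     0 < 1 / net_nu N 1 \<and>
     (\<forall>k l. 1 \<le> k \<and> k < l \<and> l \<le> net_K0 N \<longrightarrow> 1 / net_nu N k < 1 / net_nu N l) \<and>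
     net_delta N 0 = 0 \<and>
     (\<forall>k l. k < l \<and> l \<le> net_K0 N \<longrightarrow> net_delta N k < net_delta N l) \<and>
     (\<forall>(i, j)\<in>arcs N. \<forall>k l. 1 \<le> k \<and> k < l \<and> l \<le> net_K N i \<longrightarrow>
        net_alpha N i j k > net_alpha N i j l \<and> net_phi N i j k \<le> net_phi N i j l)"

definition K_exp :: "(real \<times> real \<times> real) set" where
  "K_exp = {(a1, a2, a3). a3 \<le> a2 * ln (a1 / a2) \<and> a1 > 0 \<and> a2 > 0}
         \<union> {(a1, a2, a3). a2 = 0 \<and> a1 \<ge> 0 \<and> a3 \<le> 0}"

type_synonym 'z arr1 = "'z \<Rightarrow> real"
type_synonym 'z arr2 = "'z \<Rightarrow> 'z \<Rightarrow> real"
type_synonym 'z arr3 = "'z \<Rightarrow> 'z \<Rightarrow> nat \<Rightarrow> real"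
type_synonym 'z arrk = "'z \<Rightarrow> nat \<Rightarrow> real"

definition linear_constraints ::
  "'z network \<Rightarrow> 'z arr1 \<Rightarrow> 'z arr3 \<Rightarrow> 'z arr2 \<Rightarrow> 'z arr2 \<Rightarrow> bool" where
  "linear_constraints N a d e f \<longleftrightarrow>
     (\<forall>(i, j)\<in>arcs N. (\<Sum>k=1..net_K N i. net_nu N k * d i j k) = net_mu N i j * f i j) \<and>
     (\<forall>i\<in>net_zones N.
        (\<Sum>j\<in>orig_e N i. net_mu_e N j i * e j i) + (\<Sum>j\<in>orig N i. net_mu N j i * f j i)
        = (\<Sum>j\<in>net_dest_e N i. net_mu_e N i j * e i j) + (\<Sum>j\<in>net_dest N i. net_mu N i j * f i j)) \<and>
     (\<Sum>i\<in>net_zones N. a i + (\<Sum>j\<in>net_dest_e N i. e i j)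
        + (\<Sum>j\<in>net_dest N i. f i j + (\<Sum>k=1..net_K N i. d i j k))) = 1 \<and>
     (\<forall>i\<in>net_zones N. a i \<ge> 0) \<and>
     (\<forall>(i, j)\<in>arcs N. \<forall>k\<in>{1..net_K N i}. d i j k \<ge> 0) \<and>
     (\<forall>(i, j)\<in>arcs_e N. e i j \<ge> 0) \<and>
     (\<forall>(i, j)\<in>arcs N. f i j \<ge> 0)"

definition match_exponent :: "'z network \<Rightarrow> 'z arr1 \<Rightarrow> 'z arr2 \<Rightarrow> 'z \<Rightarrow> nat \<Rightarrow> real" where
  "match_exponent N a e i k =
     - net_omega N * (net_delta N k)\<^sup>2 * (a i + (\<Sum>j\<in>orig_e N i. net_zeta N j i * e j i))
       / net_sigma N i"

fun FP3_objective ::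
  "'z network \<Rightarrow> 'z arr1 \<times> 'z arr3 \<times> 'z arr2 \<times> 'z arr2 \<times> 'z arr3 \<times> 'z arr3 \<times> 'z arrk \<Rightarrow> real" where
  "FP3_objective N (a, d, e, f, x, p, q) =
     (\<Sum>(i, j)\<in>arcs N. \<Sum>k=1..net_K N i. net_nu N k * d i j k * (x i j k - net_phi N i j k))
     - (\<Sum>(i, j)\<in>arcs_e N. net_psi N i j * net_mu_e N i j * e i j)"

fun FP3_feasible ::
  "'z network \<Rightarrow> 'z arr1 \<times> 'z arr3 \<times> 'z arr2 \<times> 'z arr2 \<times> 'z arr3 \<times> 'z arr3 \<times> 'z arrk \<Rightarrow> bool" where
  "FP3_feasible N (a, d, e, f, x, p, q) \<longleftrightarrow>
     linear_constraints N a d e f \<and>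
     (\<forall>i\<in>net_zones N. \<forall>k\<in>{1..net_K N i}.
        (\<Sum>k'=1..k. q i k') = 1 - exp (match_exponent N a e i k)) \<and>
     (\<forall>(i, j)\<in>arcs N. \<forall>k\<in>{1..net_K N i}.
        p i j k = exp (net_alpha N i j k - net_beta N i j * x i j k)
                  / (1 + exp (net_alpha N i j k - net_beta N i j * x i j k)) \<and>
        net_lam N i j * q i k * p i j k = net_nu N k * d i j k)"

fun CP3_objective ::
  "'z network \<Rightarrow> 'z arr1 \<times> 'z arr3 \<times> 'z arr2 \<times> 'z arr2 \<times> 'z arr3 \<times> 'z arrk \<Rightarrow> real" where
  "CP3_objective N (a, d, e, f, u, q) =
     (\<Sum>(i, j)\<in>arcs N. \<Sum>k=1..net_K N i.
        net_nu N k * u i j k - net_nu N k * net_phi N i j k * d i j k)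
     - (\<Sum>(i, j)\<in>arcs_e N. net_psi N i j * net_mu_e N i j * e i j)"

fun CP3_feasible ::
  "'z network \<Rightarrow> 'z arr1 \<times> 'z arr3 \<times> 'z arr2 \<times> 'z arr2 \<times> 'z arr3 \<times> 'z arrk \<Rightarrow> bool" where
  "CP3_feasible N (a, d, e, f, u, q) \<longleftrightarrow>
     linear_constraints N a d e f \<and>
     (\<forall>i\<in>net_zones N. \<forall>k\<in>{1..net_K N i}. q i k \<ge> 0) \<and>
     (\<forall>i\<in>net_zones N. \<forall>k\<in>{1..net_K N i}.
        (1 - (\<Sum>k'=1..k. q i k'), 1, match_exponent N a e i k) \<in> K_exp) \<and>
     (\<forall>(i, j)\<in>arcs N. \<forall>k\<in>{1..net_K N i}.
        (net_lam N i j * q i k - net_nu N k * d i j k,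
         net_nu N k * d i j k,
         net_beta N i j * net_nu N k * u i j k - net_alpha N i j k * net_nu N k * d i j k) \<in> K_exp)"

end

theory Submission
  imports Defs
begin

text \<open>
  CP3 is a convex relaxation of FP3: putting \<open>u = d * x\<close> turns an FP3 point into a CP3 point with the
  same objective. So it suffices that the relaxed constraints are tight at an optimum of CP3.
  Raising \<open>u\<close> shows that the demand cone constraint is tight, and the infinite slope of the reward at
  zero demand shows that \<open>d\<close> vanishes only together with \<open>q\<close>; here strong connectivity provides a
  feasible point with positive demand to move to. For the matching constraint, if the partial sums
  of \<open>q i\<close> are slack at \<open>m\<close> and at all later classes, then \<open>q i m\<close> can be raised for free, contradicting
  tightness. Otherwise some class \<open>m + 1\<close> with \<open>q i (m + 1) > 0\<close> follows a slack class \<open>m\<close>, and moving a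
  fraction of the supply, trips and rewards of class \<open>m + 1\<close> to class \<open>m\<close> strictly improves the
  objective: \<open>K_exp\<close> is a convex cone, \<open>alpha\<close> is larger and \<open>phi\<close> no larger at \<open>m\<close>, and since pickup
  at \<open>m\<close> is faster, the freed mass can be added to \<open>a i\<close>, which only relaxes the matching constraint.
\<close>

section \<open>The exponential cone as a convex cone\<close>

lemma K_exp_zero_iff: "(w, 0, z) \<in> K_exp \<longleftrightarrow> w \<ge> 0 \<and> z \<le> 0"
  by (auto simp: K_exp_def)

lemma K_exp_pos_iff: "y > 0 \<Longrightarrow> (w, y, z) \<in> K_exp \<longleftrightarrow> w > 0 \<and> z \<le> y * ln (w / y)"
  by (auto simp: K_exp_def)

text \<open>Positivity of \<open>w\<close> comes from \<open>exp z > 0\<close>. In this form the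
  matching cone constraint becomes an inequality between a partial sum of \<open>q\<close> and an
  exponential.\<close>

lemma K_exp_one_iff: "(w, 1, z) \<in> K_exp \<longleftrightarrow> exp z \<le> w"
proof -
  have "w > 0" if "exp z \<le> w"
    using that exp_gt_zero[of z] by linarith
  then show ?thesis
    by (auto simp: K_exp_pos_iff ln_ge_iff)
qed

lemma K_exp_D: "(w, y, z) \<in> K_exp \<Longrightarrow> w \<ge> 0 \<and> y \<ge> 0"
  by (auto simp: K_exp_def)

lemma K_exp_scale:
  assumes "(w, y, z) \<in> K_exp" "t \<ge> 0"
  shows "(t * w, t * y, t * z) \<in> K_exp"
proof (cases "t = 0")
  case False
  then show ?thesis
    using assms
    by (auto simp: K_exp_def mult_nonneg_nonpos mult.assoc intro!: mult_left_mono)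
qed (simp add: K_exp_def)

text \<open>For \<open>y > 0\<close> this is monotonicity of \<open>ln\<close>; the face
  \<open>y = 0\<close> only asks for signs. It serves the degenerate cases of
  \<open>K_exp_add\<close> and, later, the effect of enlarging \<open>q\<close> with demand
  unchanged.\<close>

lemma K_exp_add_left:
  assumes "(w, y, z) \<in> K_exp" "w' \<ge> 0" "z' \<le> 0"
  shows "(w + w', y, z + z') \<in> K_exp"
proof (cases "y = 0")
  case False
  then have y: "y > 0"
    using K_exp_D[OF assms(1)] by simp
  then have w: "w > 0" "z \<le> y * ln (w / y)"
    using assms(1) by (auto simp: K_exp_pos_iff)
  have "ln (w / y) \<le> ln ((w + w') / y)"
    using y w assms by (simp add: divide_right_mono)
  then have "y * ln (w / y) \<le> y * ln ((w + w') / y)"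
    using y by simp
  then show ?thesis
    using y w assms unfolding K_exp_pos_iff[OF y] by linarith
qed (use assms in \<open>simp add: K_exp_zero_iff\<close>)

text \<open>Each term is bounded by the tangent estimate \<open>ln s <= s - 1\<close> at the pooled
  ratio \<open>S\<close>. The errors \<open>w / S - y\<close> of the two pairs cancel, because
  \<open>S\<close> is the ratio of the sums.\<close>

lemma log_sum_inequality:
  fixes a a' b b' :: real
  assumes "a > 0" "a' > 0" "b > 0" "b' > 0"
  shows "b * ln (a / b) + b' * ln (a' / b') \<le> (b + b') * ln ((a + a') / (b + b'))"
proof -
  define S where "S = (a + a') / (b + b')"
  have S: "S > 0"
    using assms by (simp add: S_def)
  have *: "y * ln (w / y) \<le> y * ln S + (w / S - y)" if "w > 0" "y > 0" for w y
  proof -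
    have "ln (w / y) - ln S = ln (w / y / S)"
      using that S by (simp add: ln_div ln_mult)
    also have "\<dots> \<le> w / y / S - 1"
      using that S by (intro ln_le_minus_one) simp
    finally have "y * (ln (w / y) - ln S) \<le> y * (w / y / S - 1)"
      using that by (intro mult_left_mono) auto
    then show ?thesis
      using that S by (simp add: algebra_simps)
  qed
  have "(a + a') / S = b + b'"
    using assms by (simp add: S_def)
  then have "a / S + a' / S = b + b'"
    by (simp add: add_divide_distrib)
  then show ?thesis
    using *[of a b] *[of a' b'] assms unfolding S_def[symmetric] by (simp add: algebra_simps)
qed

lemma K_exp_add:
  assumes "(w, y, z) \<in> K_exp" "(w', y', z') \<in> K_exp"
  shows "(w + w', y + y', z + z') \<in> K_exp"
proof -
  consider "y = 0" | "y' = 0" | "y > 0" "y' > 0"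
    using K_exp_D[OF assms(1)] K_exp_D[OF assms(2)] by linarith
  then show ?thesis
  proof cases
    case 1
    then show ?thesis
      using K_exp_add_left[OF assms(2), of w z] assms(1) by (simp add: K_exp_zero_iff add.commute)
  next
    case 2
    then show ?thesis
      using K_exp_add_left[OF assms(1), of w' z'] assms(2) by (simp add: K_exp_zero_iff)
  next
    case 3
    then show ?thesis
      using assms log_sum_inequality[of w w' y y'] by (auto simp: K_exp_pos_iff)
  qed
qed

lemma K_exp_convex:
  assumes "(w, y, z) \<in> K_exp" "(w', y', z') \<in> K_exp" "s \<ge> 0" "t \<ge> 0"
  shows "(s * w + t * w', s * y + t * y', s * z + t * z') \<in> K_exp"
  using assms by (intro K_exp_add K_exp_scale)

lemma is_arg_max_real_iff:
  fixes g :: "'b \<Rightarrow> real"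
  shows "is_arg_max g P y \<longleftrightarrow> P y \<and> (\<forall>z. P z \<longrightarrow> g z \<le> g y)"
  by (auto simp: is_arg_max_def not_less)

lemma linear_constraintsD:
  assumes "linear_constraints N a d e f"
  shows "(i, j) \<in> arcs N \<Longrightarrow> (\<Sum>k=1..net_K N i. net_nu N k * d i j k) = net_mu N i j * f i j"
    and "i \<in> net_zones N \<Longrightarrow> a i \<ge> 0"
    and "(i, j) \<in> arcs N \<Longrightarrow> k \<in> {1..net_K N i} \<Longrightarrow> d i j k \<ge> 0"
    and "(i, j) \<in> arcs_e N \<Longrightarrow> e i j \<ge> 0"
    and "(i, j) \<in> arcs N \<Longrightarrow> f i j \<ge> 0"
  using assms by (auto simp: linear_constraints_def)

section \<open>Sign and monotonicity properties of the network data\<close>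

context
  fixes N :: "'z network"
  assumes network: "valid_network N"
begin

lemma finite_zones: "finite (net_zones N)"
  using network by (simp add: valid_network_def)

lemma dest_subset: "i \<in> net_zones N \<Longrightarrow> net_dest N i \<subseteq> net_zones N"
  and dest_e_subset: "i \<in> net_zones N \<Longrightarrow> net_dest_e N i \<subseteq> net_zones N"
  using network by (auto simp: valid_network_def)

lemma finite_dest: "i \<in> net_zones N \<Longrightarrow> finite (net_dest N i)"
  and finite_dest_e: "i \<in> net_zones N \<Longrightarrow> finite (net_dest_e N i)"
  using dest_subset dest_e_subset finite_zones finite_subset by metis+

lemma finite_orig_e: "finite (orig_e N i)"
  using finite_zones by (simp add: orig_e_def)

lemma arcs_Sigma: "arcs N = Sigma (net_zones N) (net_dest N)"
  by (auto simp: arcs_def)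

lemma finite_arcs: "finite (arcs N)"
  unfolding arcs_Sigma using finite_zones finite_dest by auto

lemma arc_params_pos:
  assumes "(i, j) \<in> arcs N"
  shows "net_mu N i j > 0" "net_lam N i j > 0" "net_beta N i j > 0"
  using network assms by (auto simp: valid_network_def)

lemma arc_e_params:
  assumes "(i, j) \<in> arcs_e N"
  shows "net_mu_e N i j > 0" "net_zeta N i j \<ge> 0"
  using network assms by (auto simp: valid_network_def)

lemma omega_pos: "net_omega N > 0"
  and sigma_pos: "i \<in> net_zones N \<Longrightarrow> net_sigma N i > 0"
  using network by (auto simp: valid_network_def)

lemma K_le_K0: "i \<in> net_zones N \<Longrightarrow> net_K N i \<le> net_K0 N"
  unfolding net_K0_def using finite_zones by (intro Max_ge) auto

lemma inverse_nu_less: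
  assumes "i \<in> net_zones N" "1 \<le> k" "k < l" "l \<le> net_K N i"
  shows "1 / net_nu N k < 1 / net_nu N l"
  using network assms K_le_K0[of i] unfolding valid_network_def by auto

text \<open>Only the first reciprocal is assumed positive; the later ones exceed it, and a positive
  reciprocal forces a positive rate.\<close>

lemma nu_pos:
  assumes "i \<in> net_zones N" "k \<in> {1..net_K N i}"
  shows "net_nu N k > 0"
proof -
  have 1: "0 < 1 / net_nu N 1"
    using network by (simp add: valid_network_def)
  have "0 < 1 / net_nu N k"
  proof (cases "k = 1")
    case False
    then have "1 / net_nu N 1 < 1 / net_nu N k"
      using assms by (intro inverse_nu_less[of i]) auto
    with 1 show ?thesis
      by linarith
  qed (use 1 in simp)
  then show ?thesis
    by (simp add: zero_less_divide_iff)
qed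

lemma delta_zero: "net_delta N 0 = 0"
  using network by (simp add: valid_network_def)

lemma delta_mono:
  assumes "i \<in> net_zones N" "k \<le> l" "l \<le> net_K N i"
  shows "net_delta N k \<le> net_delta N l"
proof (cases "k = l")
  case False
  then have "net_delta N k < net_delta N l"
    using network assms K_le_K0[of i] unfolding valid_network_def by auto
  then show ?thesis
    by simp
qed simp

lemma delta_pos:
  assumes "i \<in> net_zones N" "k \<in> {1..net_K N i}"
  shows "net_delta N k > 0"
proof -
  have "\<forall>k l. k < l \<and> l \<le> net_K0 N \<longrightarrow> net_delta N k < net_delta N l"
    using network by (simp add: valid_network_def)
  then have "net_delta N 0 < net_delta N k"
    using assms K_le_K0[of i] by auto
  then show ?thesis
    by (simp add: delta_zero)
qed

lemma alpha_less:
  assumes "(i, j) \<in> arcs N" "1 \<le> k" "k < l" "l \<le> net_K N i"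
  shows "net_alpha N i j l < net_alpha N i j k" "net_phi N i j k \<le> net_phi N i j l"
proof -
  have "\<forall>(i, j)\<in>arcs N. \<forall>k l. 1 \<le> k \<and> k < l \<and> l \<le> net_K N i \<longrightarrow>
        net_alpha N i j k > net_alpha N i j l \<and> net_phi N i j k \<le> net_phi N i j l"
    using network unfolding valid_network_def by blast
  then show "net_alpha N i j l < net_alpha N i j k" "net_phi N i j k \<le> net_phi N i j l"
    using assms by auto
qed

lemma supply_nonneg:
  assumes "linear_constraints N a d e f" "i \<in> net_zones N"
  shows "a i + (\<Sum>j\<in>orig_e N i. net_zeta N j i * e j i) \<ge> 0"
proof -
  have "(\<Sum>j\<in>orig_e N i. net_zeta N j i * e j i) \<ge> 0"
  proof (rule sum_nonneg)
    fix j assume "j \<in> orig_e N i"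
    then have "(j, i) \<in> arcs_e N"
      by (simp add: orig_e_def)
    then show "net_zeta N j i * e j i \<ge> 0"
      using arc_e_params(2) assms(1) by (auto simp: linear_constraints_def)
  qed
  moreover have "a i \<ge> 0"
    using assms by (simp add: linear_constraints_def)
  ultimately show ?thesis
    by simp
qed

text \<open>Radii are nonnegative because they start at zero, so their squares grow with the class,
  and they multiply a nonnegative supply.\<close>

lemma match_exponent_antimono:
  assumes "linear_constraints N a d e f" "i \<in> net_zones N" "k \<le> l" "l \<le> net_K N i"
  shows "match_exponent N a e i l \<le> match_exponent N a e i k"
proof -
  have "net_delta N 0 \<le> net_delta N k" "net_delta N k \<le> net_delta N l"
    using assms by (auto intro!: delta_mono[of i])
  then have "(net_delta N k)\<^sup>2 \<le> (net_delta N l)\<^sup>2"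
    by (intro power_mono) (auto simp: delta_zero)
  then have "net_omega N * (net_delta N k)\<^sup>2 * (a i + (\<Sum>j\<in>orig_e N i. net_zeta N j i * e j i))
      / net_sigma N i
    \<le> net_omega N * (net_delta N l)\<^sup>2 * (a i + (\<Sum>j\<in>orig_e N i. net_zeta N j i * e j i))
      / net_sigma N i"
    using omega_pos sigma_pos[OF assms(2)] supply_nonneg[OF assms(1,2)]
    by (intro divide_right_mono mult_right_mono mult_left_mono) auto
  then show ?thesis
    by (simp add: match_exponent_def)
qed

text \<open>Extends the matching equation to class 0, where the partial sum is empty and
  \<open>1 - exp 0 = 0\<close>.\<close>

lemma match_exponent_zero [simp]: "match_exponent N a e i 0 = 0"
  by (simp add: match_exponent_def delta_zero)

lemma match_exponent_mono_supply:
  assumes "i \<in> net_zones N" "a i \<le> a' i"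
  shows "match_exponent N a' e i k \<le> match_exponent N a e i k"
proof -
  have "net_omega N * (net_delta N k)\<^sup>2 * (a i + (\<Sum>j\<in>orig_e N i. net_zeta N j i * e j i))
      / net_sigma N i
    \<le> net_omega N * (net_delta N k)\<^sup>2 * (a' i + (\<Sum>j\<in>orig_e N i. net_zeta N j i * e j i))
      / net_sigma N i"
    using omega_pos sigma_pos[OF assms(1)] assms(2)
    by (intro divide_right_mono mult_left_mono) auto
  then show ?thesis
    by (simp add: match_exponent_def)
qed

section \<open>CP3 as a relaxation of FP3\<close>

text \<open>With \<open>p = E / (1 + E)\<close>, the demand equation leaves unserved demand
  \<open>nu * d / E\<close>. The log ratio of the first two cone coordinates is therefore
  \<open>beta * x - alpha\<close>, and the cone inequality holds with equality.\<close>

lemma FP3_feasible_imp_CP3_feasible: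
  assumes "FP3_feasible N (a, d, e, f, x, p, q)"
  shows "CP3_feasible N (a, d, e, f, \<lambda>i j k. d i j k * x i j k, q)"
proof -
  have lin: "linear_constraints N a d e f"
    using assms by simp
  have Q: "(\<Sum>k'=1..k. q i k') = 1 - exp (match_exponent N a e i k)"
    if "i \<in> net_zones N" "k \<in> {1..net_K N i}" for i k
    using assms that by simp
  \<comment> \<open>\<open>q i k\<close> is a difference of consecutive values of
    \<open>1 - exp (...)\<close>; class 1 is compared with the empty sum at index 0.\<close>
  have q: "q i k \<ge> 0" if i: "i \<in> net_zones N" and k: "k \<in> {1..net_K N i}" for i k
  proof -
    obtain m where m: "k = Suc m"
      using k by (cases k) auto
    have "(\<Sum>k'=1..m. q i k') = 1 - exp (match_exponent N a e i m)"
      using Q[of i m] i k m by (cases "m = 0") auto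
    moreover have "(\<Sum>k'=1..Suc m. q i k') = 1 - exp (match_exponent N a e i (Suc m))"
      using Q[of i k] i k m by auto
    moreover have "exp (match_exponent N a e i (Suc m)) \<le> exp (match_exponent N a e i m)"
      using match_exponent_antimono[OF lin i] k m by simp
    ultimately show ?thesis
      unfolding m by (simp del: exp_le_cancel_iff)
  qed
  have "(net_lam N i j * q i k - net_nu N k * d i j k,
         net_nu N k * d i j k,
         net_beta N i j * net_nu N k * (d i j k * x i j k) - net_alpha N i j k * net_nu N k * d i j k)
        \<in> K_exp"
    if arc: "(i, j) \<in> arcs N" and k: "k \<in> {1..net_K N i}" for i j k
  proof -
    have i: "i \<in> net_zones N"
      using arc by (simp add: arcs_def)
    define E where "E = exp (net_alpha N i j k - net_beta N i j * x i j k)"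
    have E: "E > 0"
      by (simp add: E_def)
    have d: "net_nu N k * d i j k = net_lam N i j * q i k * (E / (1 + E))"
    proof -
      have "p i j k = E / (1 + E) \<and> net_lam N i j * q i k * p i j k = net_nu N k * d i j k"
        using assms arc k unfolding E_def FP3_feasible.simps by blast
      then show ?thesis
        by metis
    qed
    show ?thesis
    proof (cases "q i k = 0")
      case True
      then have "d i j k = 0"
        using d nu_pos[OF i k] by simp
      with True show ?thesis
        by (simp add: K_exp_zero_iff)
    next
      case False
      then have lq: "net_lam N i j * q i k > 0"
        using q[OF i k] arc_params_pos(2)[OF arc] by simp
      have y: "net_nu N k * d i j k > 0"
        unfolding d using lq E by simp
      have w: "net_lam N i j * q i k - net_nu N k * d i j k = net_nu N k * d i j k / E"
      proof -
        have "1 - E / (1 + E) = 1 / (1 + E)"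
          using E by (simp add: field_simps)
        then have "X - X * (E / (1 + E)) = X * (E / (1 + E)) / E" for X
          using E right_diff_distrib[of X 1 "E / (1 + E)"] by simp
        then show ?thesis
          unfolding d .
      qed
      define Y where "Y = net_nu N k * d i j k"
      have "ln (Y / E / Y) = net_beta N i j * x i j k - net_alpha N i j k"
        using y by (simp add: Y_def[symmetric] E_def ln_div)
      moreover have "net_beta N i j * net_nu N k * (d i j k * x i j k)
          - net_alpha N i j k * net_nu N k * d i j k = Y * (net_beta N i j * x i j k - net_alpha N i j k)"
        by (simp add: Y_def algebra_simps)
      ultimately show ?thesis
        using y E unfolding Y_def[symmetric] w[folded Y_def] by (simp add: K_exp_pos_iff)
    qed
  qed
  then show ?thesis
    using lin Q q by (auto simp: K_exp_one_iff)
qed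

section \<open>Convexity of the feasible set of CP3\<close>

lemma CP3_feasible_convex:
  assumes z: "CP3_feasible N (a, d, e, f, u, q)" and z': "CP3_feasible N (a', d', e', f', u', q')"
    and st: "s \<ge> 0" "t \<ge> 0" "s + t = 1"
  shows "CP3_feasible N
    (\<lambda>i. s * a i + t * a' i, \<lambda>i j k. s * d i j k + t * d' i j k,
     \<lambda>i j. s * e i j + t * e' i j, \<lambda>i j. s * f i j + t * f' i j,
     \<lambda>i j k. s * u i j k + t * u' i j k, \<lambda>i k. s * q i k + t * q' i k)"
proof -
  have lin: "linear_constraints N a d e f" "linear_constraints N a' d' e' f'"
    using z z' by simp_all
  have comb: "(\<Sum>x\<in>A. c x * (s * g x + t * g' x)) = s * (\<Sum>x\<in>A. c x * g x) + t * (\<Sum>x\<in>A. c x * g' x)"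
    for A :: "'i set" and c g g' :: "'i \<Rightarrow> real"
    by (simp add: sum.distrib sum_distrib_left algebra_simps)
  have comb1: "(\<Sum>x\<in>A. s * g x + t * g' x) = s * (\<Sum>x\<in>A. g x) + t * (\<Sum>x\<in>A. g' x)"
    for A :: "'i set" and g g' :: "'i \<Rightarrow> real"
    by (simp add: sum.distrib sum_distrib_left)
  have lin': "linear_constraints N (\<lambda>i. s * a i + t * a' i) (\<lambda>i j k. s * d i j k + t * d' i j k)
     (\<lambda>i j. s * e i j + t * e' i j) (\<lambda>i j. s * f i j + t * f' i j)"
    unfolding linear_constraints_def
  proof (intro conjI)
    show "\<forall>(i, j)\<in>arcs N. (\<Sum>k = 1..net_K N i. net_nu N k * (s * d i j k + t * d' i j k))
      = net_mu N i j * (s * f i j + t * f' i j)"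
    proof (clarify)
      fix i j assume "(i, j) \<in> arcs N"
      then have "(\<Sum>k = 1..net_K N i. net_nu N k * d i j k) = net_mu N i j * f i j"
        "(\<Sum>k = 1..net_K N i. net_nu N k * d' i j k) = net_mu N i j * f' i j"
        using linear_constraintsD(1)[OF lin(1)] linear_constraintsD(1)[OF lin(2)] by blast+
      then show "(\<Sum>k = 1..net_K N i. net_nu N k * (s * d i j k + t * d' i j k))
        = net_mu N i j * (s * f i j + t * f' i j)"
        unfolding comb by (simp add: algebra_simps)
    qed
    show "\<forall>i\<in>net_zones N.
       (\<Sum>j\<in>orig_e N i. net_mu_e N j i * (s * e j i + t * e' j i)) +
       (\<Sum>j\<in>orig N i. net_mu N j i * (s * f j i + t * f' j i)) =
       (\<Sum>j\<in>net_dest_e N i. net_mu_e N i j * (s * e i j + t * e' i j)) +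
       (\<Sum>j\<in>net_dest N i. net_mu N i j * (s * f i j + t * f' i j))"
    proof
      fix i assume i: "i \<in> net_zones N"
      have "s * ((\<Sum>j\<in>orig_e N i. net_mu_e N j i * e j i) + (\<Sum>j\<in>orig N i. net_mu N j i * f j i))
         + t * ((\<Sum>j\<in>orig_e N i. net_mu_e N j i * e' j i) + (\<Sum>j\<in>orig N i. net_mu N j i * f' j i))
        = s * ((\<Sum>j\<in>net_dest_e N i. net_mu_e N i j * e i j) + (\<Sum>j\<in>net_dest N i. net_mu N i j * f i j))
        + t * ((\<Sum>j\<in>net_dest_e N i. net_mu_e N i j * e' i j) + (\<Sum>j\<in>net_dest N i. net_mu N i j * f' i j))"
        using lin i unfolding linear_constraints_def by simp
      then show "(\<Sum>j\<in>orig_e N i. net_mu_e N j i * (s * e j i + t * e' j i)) +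
       (\<Sum>j\<in>orig N i. net_mu N j i * (s * f j i + t * f' j i)) =
       (\<Sum>j\<in>net_dest_e N i. net_mu_e N i j * (s * e i j + t * e' i j)) +
       (\<Sum>j\<in>net_dest N i. net_mu N i j * (s * f i j + t * f' i j))"
        unfolding comb by (simp add: algebra_simps)
    qed
    have "(\<Sum>i\<in>net_zones N. s * a i + t * a' i + (\<Sum>j\<in>net_dest_e N i. s * e i j + t * e' i j) +
        (\<Sum>j\<in>net_dest N i. s * f i j + t * f' i j + (\<Sum>k = 1..net_K N i. s * d i j k + t * d' i j k)))
      = s * (\<Sum>i\<in>net_zones N. a i + (\<Sum>j\<in>net_dest_e N i. e i j)
        + (\<Sum>j\<in>net_dest N i. f i j + (\<Sum>k=1..net_K N i. d i j k)))
      + t * (\<Sum>i\<in>net_zones N. a' i + (\<Sum>j\<in>net_dest_e N i. e' i j)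
        + (\<Sum>j\<in>net_dest N i. f' i j + (\<Sum>k=1..net_K N i. d' i j k)))"
      by (simp add: sum.distrib sum_distrib_left algebra_simps)
    also have "\<dots> = 1"
      using lin st unfolding linear_constraints_def by simp
    finally show "(\<Sum>i\<in>net_zones N. s * a i + t * a' i + (\<Sum>j\<in>net_dest_e N i. s * e i j + t * e' i j) +
        (\<Sum>j\<in>net_dest N i. s * f i j + t * f' i j + (\<Sum>k = 1..net_K N i. s * d i j k + t * d' i j k))) = 1" .
    have nonneg: "s * g + t * g' \<ge> 0" if "g \<ge> 0" "g' \<ge> 0" for g g'
      using that st by simp
    show "\<forall>i\<in>net_zones N. s * a i + t * a' i \<ge> 0"
      "\<forall>(i, j)\<in>arcs N. \<forall>k\<in>{1..net_K N i}. s * d i j k + t * d' i j k \<ge> 0"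
      "\<forall>(i, j)\<in>arcs_e N. s * e i j + t * e' i j \<ge> 0"
      "\<forall>(i, j)\<in>arcs N. s * f i j + t * f' i j \<ge> 0"
      using linear_constraintsD(2-5)[OF lin(1)] linear_constraintsD(2-5)[OF lin(2)] by (auto intro!: nonneg)
  qed
  \<comment> \<open>The exponent is linear in \<open>a\<close> and \<open>e\<close>, so both cone
    constraints combine coordinate by coordinate.\<close>
  have match: "match_exponent N (\<lambda>i. s * a i + t * a' i) (\<lambda>i j. s * e i j + t * e' i j) i k
    = s * match_exponent N a e i k + t * match_exponent N a' e' i k" for i k
    unfolding match_exponent_def comb by (simp add: algebra_simps add_divide_distrib diff_divide_distrib)
  have "(1 - (\<Sum>k'=1..k. s * q i k' + t * q' i k'), 1,
      s * match_exponent N a e i k + t * match_exponent N a' e' i k) \<in> K_exp"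
    if "i \<in> net_zones N" "k \<in> {1..net_K N i}" for i k
  proof -
    have "(s * (1 - (\<Sum>k'=1..k. q i k')) + t * (1 - (\<Sum>k'=1..k. q' i k')), s * 1 + t * 1,
      s * match_exponent N a e i k + t * match_exponent N a' e' i k) \<in> K_exp"
      using z z' that st by (intro K_exp_convex) auto
    moreover have "s * (1 - (\<Sum>k'=1..k. q i k')) + t * (1 - (\<Sum>k'=1..k. q' i k'))
      = 1 - (\<Sum>k'=1..k. s * q i k' + t * q' i k')"
      unfolding comb1 using st by (simp add: algebra_simps)
    ultimately show ?thesis
      using st by simp
  qed
  moreover have "(net_lam N i j * (s * q i k + t * q' i k) - net_nu N k * (s * d i j k + t * d' i j k),
         net_nu N k * (s * d i j k + t * d' i j k),
         net_beta N i j * net_nu N k * (s * u i j k + t * u' i j k)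
         - net_alpha N i j k * net_nu N k * (s * d i j k + t * d' i j k)) \<in> K_exp"
    if "(i, j) \<in> arcs N" "k \<in> {1..net_K N i}" for i j k
  proof -
    have "(s * (net_lam N i j * q i k - net_nu N k * d i j k)
          + t * (net_lam N i j * q' i k - net_nu N k * d' i j k),
         s * (net_nu N k * d i j k) + t * (net_nu N k * d' i j k),
         s * (net_beta N i j * net_nu N k * u i j k - net_alpha N i j k * net_nu N k * d i j k)
         + t * (net_beta N i j * net_nu N k * u' i j k - net_alpha N i j k * net_nu N k * d' i j k))
        \<in> K_exp"
      using z z' that st by (intro K_exp_convex) auto
    then show ?thesis
      by (simp add: algebra_simps)
  qed
  moreover have "s * q i k + t * q' i k \<ge> 0" if "i \<in> net_zones N" "k \<in> {1..net_K N i}" for i k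
    using z z' that st by auto
  ultimately show ?thesis
    using lin' by (auto simp: match)
qed

lemma CP3_objective_affine:
  "CP3_objective N
    (\<lambda>i. s * a i + t * a' i, \<lambda>i j k. s * d i j k + t * d' i j k,
     \<lambda>i j. s * e i j + t * e' i j, \<lambda>i j. s * f i j + t * f' i j,
     \<lambda>i j k. s * u i j k + t * u' i j k, \<lambda>i k. s * q i k + t * q' i k)
   = s * CP3_objective N (a, d, e, f, u, q) + t * CP3_objective N (a', d', e', f', u', q')"
  by (simp add: sum.distrib sum_distrib_left sum_subtractf split_def algebra_simps)

section \<open>A feasible point of CP3 with positive demand on a given arc\<close>

text \<open>A unit flow from source \<open>j\<close> to sink \<open>i\<close>, built along a path by
  adding one unit on its last arc. It brings vehicles back empty after a passenger trip from
  \<open>i\<close> to \<open>j\<close>.\<close>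

lemma exists_return_flow:
  assumes "(j, i) \<in> (arcs_e N)\<^sup>*"
  shows "\<exists>g :: 'z \<Rightarrow> 'z \<Rightarrow> real. (\<forall>v w. g v w \<ge> 0) \<and>
    (\<forall>v\<in>net_zones N. (\<Sum>w\<in>orig_e N v. g w v) + of_bool (v = j)
      = (\<Sum>w\<in>net_dest_e N v. g v w) + of_bool (v = i))"
  using assms
proof (induction rule: rtrancl_induct)
  case base
  then show ?case
    by (intro exI[of _ "\<lambda>_ _. 0"]) simp
next
  case (step y z)
  then obtain g :: "'z \<Rightarrow> 'z \<Rightarrow> real" where g: "\<forall>v w. g v w \<ge> 0"
    and bal: "\<And>v. v \<in> net_zones N \<Longrightarrow> (\<Sum>w\<in>orig_e N v. g w v) + of_bool (v = j)
      = (\<Sum>w\<in>net_dest_e N v. g v w) + of_bool (v = y)"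
    by blast
  have yz: "y \<in> orig_e N z" "z \<in> net_dest_e N y"
    using step(2) by (auto simp: orig_e_def arcs_e_def)
  define g' where "g' v w = g v w + (if w = z \<and> v = y then 1 else 0)" for v w
  have "(\<Sum>w\<in>orig_e N v. g' w v) + of_bool (v = j)
      = (\<Sum>w\<in>net_dest_e N v. g' v w) + of_bool (v = z)" if v: "v \<in> net_zones N" for v
  proof -
    have "(\<Sum>w\<in>orig_e N v. g' w v) = (\<Sum>w\<in>orig_e N v. g w v) + of_bool (v = z)"
      using yz by (cases "v = z") (auto simp: g'_def sum.distrib finite_orig_e)
    moreover have "(\<Sum>w\<in>net_dest_e N v. g' v w) = (\<Sum>w\<in>net_dest_e N v. g v w) + of_bool (v = y)"
      using yz finite_dest_e[OF v] by (cases "v = y") (auto simp: g'_def sum.distrib)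
    ultimately show ?thesis
      using bal[OF v] by simp
  qed
  then show ?case
    using g by (intro exI[of _ g']) (auto simp: g'_def)
qed

text \<open>Trips of class \<open>k\<close> circulate at a small rate \<open>r\<close> from
  \<open>i\<close> to \<open>j\<close> and back empty along the return flow, while all remaining
  mass idles at \<open>i\<close>.\<close>

lemma exists_CP3_feasible_pos_demand:
  assumes arc: "(i, j) \<in> arcs N" and k: "k \<in> {1..net_K N i}"
  shows "\<exists>a d e f u q. CP3_feasible N (a, d, e, f, u, q) \<and> d i j k > 0"
proof -
  have i: "i \<in> net_zones N" and j: "j \<in> net_dest N i"
    using arc by (auto simp: arcs_def)
  have j': "j \<in> net_zones N"
    using dest_subset[OF i] j by auto
  have "(j, i) \<in> (arcs_e N)\<^sup>*"
    using network i j' by (simp add: valid_network_def)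
  then obtain g :: "'z \<Rightarrow> 'z \<Rightarrow> real" where g: "\<And>v w. g v w \<ge> 0"
    and bal: "\<And>v. v \<in> net_zones N \<Longrightarrow> (\<Sum>w\<in>orig_e N v. g w v) + of_bool (v = j)
      = (\<Sum>w\<in>net_dest_e N v. g v w) + of_bool (v = i)"
    using exists_return_flow by blast
  note pos = arc_params_pos[OF arc] and nu = nu_pos[OF i k]
  \<comment> \<open>\<open>C\<close> is the mass occupied per unit of circulation: empty returns,
    the passenger trip and the pickup.\<close>
  define C where "C = (\<Sum>v\<in>net_zones N. \<Sum>w\<in>net_dest_e N v. g v w / net_mu_e N v w)
    + 1 / net_mu N i j + 1 / net_nu N k"
  have "(\<Sum>v\<in>net_zones N. \<Sum>w\<in>net_dest_e N v. g v w / net_mu_e N v w) \<ge> 0"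
    using g arc_e_params(1) by (intro sum_nonneg divide_nonneg_nonneg) (auto simp: arcs_e_def less_imp_le)
  then have C: "C > 0"
    unfolding C_def using pos nu by (intro add_nonneg_pos add_pos_pos) auto
  \<comment> \<open>Half of the total mass idling at \<open>i\<close> gives the exponent
    \<open>- E\<close> already at class 1, so a supply of \<open>s = 1 - exp (- E)\<close> is
    available at every class.\<close>
  define E where "E = net_omega N * (net_delta N 1)\<^sup>2 * (1 / 2) / net_sigma N i"
  have "net_delta N 1 > 0"
    using delta_pos[OF i, of 1] k by simp
  then have E: "E > 0"
    unfolding E_def using omega_pos sigma_pos[OF i] by simp
  define s where "s = 1 - exp (- E)"
  have s: "s > 0"
    using E by (simp add: s_def)
  \<comment> \<open>The first bound keeps at least half of the mass idle; the second leaves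
    \<open>lam * s - r\<close> positive, as the demand cone requires.\<close>
  define r where "r = min (1 / (2 * C)) (net_lam N i j * s / 2)"
  have r: "r > 0" "r \<le> 1 / (2 * C)" "r < net_lam N i j * s"
    using C s pos mult_pos_pos[OF pos(2) s] unfolding r_def by (auto simp: min_less_iff_disj)
  have rC: "r * C \<le> 1 / 2"
    using r(2) C by (simp add: field_simps)
  define a where "a v = (if v = i then 1 - r * C else 0)" for v
  define e where "e v w = r * g v w / net_mu_e N v w" for v w
  define f where "f v w = (if w = j \<and> v = i then r / net_mu N i j else 0)" for v w
  define d where "d v w l = (if l = k \<and> w = j \<and> v = i then r / net_nu N k else 0)" for v w l
  define q where "q v l = (if l = k \<and> v = i then s else 0)" for v l
  \<comment> \<open>This value solves the demand cone constraint with equality.\<close>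
  define u where "u v w l = (if l = k \<and> w = j \<and> v = i
    then (net_alpha N i j k * r + r * ln ((net_lam N i j * s - r) / r)) / (net_beta N i j * net_nu N k)
    else 0)" for v w l
  have muf: "net_mu N v w * f v w = (if w = j \<and> v = i then r else 0)" for v w
    using pos by (simp add: f_def)
  have nud: "net_nu N l * d v w l = (if l = k \<and> w = j \<and> v = i then r else 0)" for v w l
    using nu by (simp add: d_def)
  have mue: "net_mu_e N v w * e v w = r * g v w" if "(v, w) \<in> arcs_e N" for v w
    using arc_e_params(1)[OF that] by (simp add: e_def)
  have e0: "e v w \<ge> 0" if "(v, w) \<in> arcs_e N" for v w
    using arc_e_params(1)[OF that] g r by (simp add: e_def)
  have lin: "linear_constraints N a d e f"
    unfolding linear_constraints_def
  proof (intro conjI)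
    show "\<forall>(v, w)\<in>arcs N. (\<Sum>l = 1..net_K N v. net_nu N l * d v w l) = net_mu N v w * f v w"
      unfolding nud muf
    proof (clarify)
      fix v w
      show "(\<Sum>l = 1..net_K N v. if l = k \<and> w = j \<and> v = i then r else 0)
        = (if w = j \<and> v = i then r else 0)"
        using k by (cases "w = j \<and> v = i") auto
    qed
    show "\<forall>v\<in>net_zones N.
       (\<Sum>w\<in>orig_e N v. net_mu_e N w v * e w v) + (\<Sum>w\<in>orig N v. net_mu N w v * f w v) =
       (\<Sum>w\<in>net_dest_e N v. net_mu_e N v w * e v w) + (\<Sum>w\<in>net_dest N v. net_mu N v w * f v w)"
    proof
      fix v assume v: "v \<in> net_zones N"
      have "(\<Sum>w\<in>orig_e N v. net_mu_e N w v * e w v) = r * (\<Sum>w\<in>orig_e N v. g w v)"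
        unfolding sum_distrib_left by (intro sum.cong) (auto simp: orig_e_def mue)
      moreover have "(\<Sum>w\<in>net_dest_e N v. net_mu_e N v w * e v w) = r * (\<Sum>w\<in>net_dest_e N v. g v w)"
        unfolding sum_distrib_left using v by (intro sum.cong) (auto simp: arcs_e_def mue)
      moreover have "(\<Sum>w\<in>orig N v. net_mu N w v * f w v) = r * of_bool (v = j)"
        unfolding muf using i arc by (cases "v = j") (auto simp: orig_def finite_zones)
      moreover have "(\<Sum>w\<in>net_dest N v. net_mu N v w * f v w) = r * of_bool (v = i)"
        unfolding muf using j finite_dest[OF v] by (cases "v = i") auto
      ultimately show "(\<Sum>w\<in>orig_e N v. net_mu_e N w v * e w v) + (\<Sum>w\<in>orig N v. net_mu N w v * f w v) =
       (\<Sum>w\<in>net_dest_e N v. net_mu_e N v w * e v w) + (\<Sum>w\<in>net_dest N v. net_mu N v w * f v w)"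
        using bal[OF v] by (simp flip: distrib_left)
    qed
    have "(\<Sum>w\<in>net_dest N v. f v w + (\<Sum>l = 1..net_K N v. d v w l))
      = (if v = i then r / net_mu N i j + r / net_nu N k else 0)" if v: "v \<in> net_zones N" for v
    proof -
      have "(\<Sum>l = 1..net_K N v. d v w l) = (if w = j \<and> v = i then r / net_nu N k else 0)" for w
        unfolding d_def using k by (cases "w = j \<and> v = i") auto
      then have "(\<Sum>w\<in>net_dest N v. f v w + (\<Sum>l = 1..net_K N v. d v w l))
        = (\<Sum>w\<in>net_dest N v. if w = j \<and> v = i then r / net_mu N i j + r / net_nu N k else 0)"
        by (intro sum.cong) (auto simp: f_def)
      also have "\<dots> = (if v = i then r / net_mu N i j + r / net_nu N k else 0)"
        using j finite_dest[OF v] by (cases "v = i") auto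
      finally show ?thesis .
    qed
    then have "(\<Sum>v\<in>net_zones N. a v + (\<Sum>w\<in>net_dest_e N v. e v w) +
        (\<Sum>w\<in>net_dest N v. f v w + (\<Sum>l = 1..net_K N v. d v w l)))
      = (\<Sum>v\<in>net_zones N. (if v = i then 1 - r * C + (r / net_mu N i j + r / net_nu N k) else 0)
        + r * (\<Sum>w\<in>net_dest_e N v. g v w / net_mu_e N v w))"
      by (intro sum.cong) (auto simp: a_def e_def sum_distrib_left)
    also have "\<dots> = 1 - r * C + (r / net_mu N i j + r / net_nu N k)
      + r * (\<Sum>v\<in>net_zones N. \<Sum>w\<in>net_dest_e N v. g v w / net_mu_e N v w)"
      using i by (simp add: sum.distrib finite_zones sum_distrib_left)
    also have "\<dots> = 1"
      by (simp add: C_def algebra_simps)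
    finally show "(\<Sum>v\<in>net_zones N. a v + (\<Sum>w\<in>net_dest_e N v. e v w) +
        (\<Sum>w\<in>net_dest N v. f v w + (\<Sum>l = 1..net_K N v. d v w l))) = 1" .
  qed (use e0 pos nu r rC in \<open>auto simp: a_def d_def f_def\<close>)
  have "exp (match_exponent N a e v l) \<le> 1 - (\<Sum>l'=1..l. q v l')"
    if v: "v \<in> net_zones N" and l: "l \<in> {1..net_K N v}" for v l
  proof (cases "v = i \<and> k \<le> l")
    case True
    then have vi: "v = i" and kl: "k \<le> l"
      by auto
    have "match_exponent N a e i l \<le> match_exponent N a e i 1"
      using match_exponent_antimono[OF lin i] l vi by simp
    also have "\<dots> \<le> match_exponent N (\<lambda>_. 1 / 2) (\<lambda>_ _. 0) i 1"
    proof -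
      have "1 / 2 \<le> a i"
        using rC by (simp add: a_def)
      moreover have "(\<Sum>w\<in>orig_e N i. net_zeta N w i * e w i) \<ge> 0"
        using e0 arc_e_params(2) by (intro sum_nonneg) (auto simp: orig_e_def)
      ultimately have "net_omega N * (net_delta N 1)\<^sup>2 * (1 / 2) / net_sigma N i
        \<le> net_omega N * (net_delta N 1)\<^sup>2 * (a i + (\<Sum>w\<in>orig_e N i. net_zeta N w i * e w i))
          / net_sigma N i"
        using omega_pos sigma_pos[OF i] by (intro divide_right_mono mult_left_mono) auto
      then show ?thesis
        by (simp add: match_exponent_def)
    qed
    also have "\<dots> = - E"
      by (simp add: match_exponent_def E_def)
    finally have "exp (match_exponent N a e i l) \<le> exp (- E)"
      by simp
    moreover have "(\<Sum>l'=1..l. q v l') = s"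
      unfolding q_def using vi kl k by auto
    ultimately show ?thesis
      by (simp add: s_def vi)
  next
    case False
    then have "(\<Sum>l'=1..l. q v l') = 0"
      by (intro sum.neutral) (auto simp: q_def)
    moreover have "match_exponent N a e v l \<le> 0"
      using match_exponent_antimono[OF lin v, of 0 l] l by simp
    ultimately show ?thesis
      by simp
  qed
  moreover have "(net_lam N v w * q v l - net_nu N l * d v w l, net_nu N l * d v w l,
      net_beta N v w * net_nu N l * u v w l - net_alpha N v w l * net_nu N l * d v w l) \<in> K_exp"
    if vw: "(v, w) \<in> arcs N" and l: "l \<in> {1..net_K N v}" for v w l
  proof (cases "v = i \<and> w = j \<and> l = k")
    case True
    then have vwl: "v = i" "w = j" "l = k"
      by auto
    have "net_beta N i j * net_nu N k * u i j k
      = net_alpha N i j k * r + r * ln ((net_lam N i j * s - r) / r)"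
      using pos nu by (simp add: u_def)
    moreover have "net_alpha N i j k * net_nu N k * d i j k = net_alpha N i j k * r"
      using nu by (simp add: d_def)
    moreover have "net_nu N k * d i j k = r"
      by (simp add: nud)
    moreover have "q i k = s"
      by (simp add: q_def)
    ultimately show ?thesis
      unfolding vwl using r by (simp only: K_exp_pos_iff) simp
  next
    case False
    then have "d v w l = 0" "u v w l = 0"
      by (auto simp: d_def u_def)
    then show ?thesis
      using arc_params_pos(2)[OF vw] s by (simp add: K_exp_zero_iff q_def)
  qed
  moreover have "q v l \<ge> 0" for v l
    using s by (simp add: q_def)
  ultimately have "CP3_feasible N (a, d, e, f, u, q)"
    using lin by (auto simp: K_exp_one_iff)
  moreover have "d i j k > 0"
    using nu r by (simp add: d_def)
  ultimately show ?thesis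
    by blast
qed

section \<open>Rewards and demands at an optimum of CP3\<close>

text \<open>Each entry of \<open>u\<close> occurs in exactly one constraint, its own demand cone
  condition, so entries can be changed independently.\<close>

lemma CP3_update_u:
  assumes z: "CP3_feasible N (a, d, e, f, u, q)"
    and arc: "(i, j) \<in> arcs N" and k: "k \<in> {1..net_K N i}"
    and v: "(net_lam N i j * q i k - net_nu N k * d i j k, net_nu N k * d i j k,
      net_beta N i j * net_nu N k * v - net_alpha N i j k * net_nu N k * d i j k) \<in> K_exp"
  defines "u' \<equiv> \<lambda>i' j' k'. if k' = k \<and> i' = i \<and> j' = j then v else u i' j' k'"
  shows "CP3_feasible N (a, d, e, f, u', q)"
    and "CP3_objective N (a, d, e, f, u', q)
      = CP3_objective N (a, d, e, f, u, q) + net_nu N k * (v - u i j k)"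
proof -
  have "(net_lam N i' j' * q i' k' - net_nu N k' * d i' j' k', net_nu N k' * d i' j' k',
      net_beta N i' j' * net_nu N k' * u' i' j' k' - net_alpha N i' j' k' * net_nu N k' * d i' j' k')
      \<in> K_exp" if "(i', j') \<in> arcs N" "k' \<in> {1..net_K N i'}" for i' j' k'
    using z v that by (cases "k' = k \<and> i' = i \<and> j' = j") (auto simp: u'_def)
  then show "CP3_feasible N (a, d, e, f, u', q)"
    using z by auto
  define T where "T w i' j' =
    (\<Sum>k'=1..net_K N i'. net_nu N k' * w i' j' k' - net_nu N k' * net_phi N i' j' k' * d i' j' k')"
    for w i' j'
  have T: "T u' i' j' = T u i' j' + (if (i', j') = (i, j) then net_nu N k * (v - u i j k) else 0)" for i' j'
  proof (cases "(i', j') = (i, j)")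
    case True
    have "T u' i j = (\<Sum>k'=1..net_K N i. (net_nu N k' * u i j k' - net_nu N k' * net_phi N i j k' * d i j k')
      + (if k' = k then net_nu N k * (v - u i j k) else 0))"
      unfolding T_def by (intro sum.cong) (auto simp: u'_def algebra_simps)
    then show ?thesis
      using True k by (simp add: sum.distrib T_def)
  qed (auto simp: T_def u'_def)
  have "(\<Sum>(i', j')\<in>arcs N. T u' i' j') = (\<Sum>x\<in>arcs N. (case x of (i', j') \<Rightarrow> T u i' j')
      + (if x = (i, j) then net_nu N k * (v - u i j k) else 0))"
    by (intro sum.cong refl, simp only: T split_paired_all prod.case)
  also have "\<dots> = (\<Sum>(i', j')\<in>arcs N. T u i' j') + net_nu N k * (v - u i j k)"
    using arc by (simp add: sum.distrib finite_arcs)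
  finally show "CP3_objective N (a, d, e, f, u', q)
      = CP3_objective N (a, d, e, f, u, q) + net_nu N k * (v - u i j k)"
    by (simp add: T_def)
qed

lemma CP3_optimal_u_ge:
  assumes opt: "is_arg_max (CP3_objective N) (CP3_feasible N) (a, d, e, f, u, q)"
    and arc: "(i, j) \<in> arcs N" and k: "k \<in> {1..net_K N i}"
    and v: "(net_lam N i j * q i k - net_nu N k * d i j k, net_nu N k * d i j k,
      net_beta N i j * net_nu N k * v - net_alpha N i j k * net_nu N k * d i j k) \<in> K_exp"
  shows "v \<le> u i j k"
proof -
  have "i \<in> net_zones N"
    using arc by (simp add: arcs_def)
  then have nu: "net_nu N k > 0"
    using nu_pos k by blast
  have z: "CP3_feasible N (a, d, e, f, u, q)"
    and max: "\<And>y. CP3_feasible N y \<Longrightarrow> CP3_objective N y \<le> CP3_objective N (a, d, e, f, u, q)"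
    using opt unfolding is_arg_max_real_iff by blast+
  have "net_nu N k * (v - u i j k) \<le> 0"
    using max[OF CP3_update_u(1)[OF z arc k v]] unfolding CP3_update_u(2)[OF z arc k v] by simp
  then show ?thesis
    using nu by (simp add: mult_le_0_iff)
qed

text \<open>The cone condition bounds \<open>u\<close> from above; comparison with the value that
  turns it into an equality gives the reverse bound.\<close>

lemma CP3_optimal_u_eq:
  assumes opt: "is_arg_max (CP3_objective N) (CP3_feasible N) (a, d, e, f, u, q)"
    and arc: "(i, j) \<in> arcs N" and k: "k \<in> {1..net_K N i}" and d: "d i j k > 0"
  shows "net_lam N i j * q i k > net_nu N k * d i j k"
    and "net_beta N i j * u i j k
      = d i j k * (net_alpha N i j k + ln ((net_lam N i j * q i k - net_nu N k * d i j k) / (net_nu N k * d i j k)))"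
proof -
  have i: "i \<in> net_zones N"
    using arc by (simp add: arcs_def)
  note nu = nu_pos[OF i k] and beta = arc_params_pos(3)[OF arc]
  have y: "net_nu N k * d i j k > 0"
    using nu d by simp
  define L where "L = ln ((net_lam N i j * q i k - net_nu N k * d i j k) / (net_nu N k * d i j k))"
  have z: "CP3_feasible N (a, d, e, f, u, q)"
    using opt unfolding is_arg_max_real_iff by blast
  then have cone: "(net_lam N i j * q i k - net_nu N k * d i j k, net_nu N k * d i j k,
      net_beta N i j * net_nu N k * u i j k - net_alpha N i j k * net_nu N k * d i j k) \<in> K_exp"
    using arc k by auto
  then show w: "net_lam N i j * q i k > net_nu N k * d i j k"
    unfolding K_exp_pos_iff[OF y] by simp
  have "net_beta N i j * net_nu N k * u i j k - net_alpha N i j k * net_nu N k * d i j k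
    \<le> net_nu N k * d i j k * L"
    using cone unfolding K_exp_pos_iff[OF y] L_def by simp
  then have "net_nu N k * (net_beta N i j * u i j k) \<le> net_nu N k * (d i j k * (net_alpha N i j k + L))"
    by (simp add: algebra_simps)
  then have le: "net_beta N i j * u i j k \<le> d i j k * (net_alpha N i j k + L)"
    using nu by simp
  define v where "v = d i j k * (net_alpha N i j k + L) / net_beta N i j"
  have v: "net_beta N i j * v = d i j k * (net_alpha N i j k + L)"
    using beta by (simp add: v_def)
  have "net_beta N i j * net_nu N k * v = net_nu N k * (d i j k * (net_alpha N i j k + L))"
    unfolding v[symmetric] by simp
  then have "v \<le> u i j k"
    using w unfolding L_def
    by (intro CP3_optimal_u_ge[OF opt arc k]) (simp add: K_exp_pos_iff[OF y] algebra_simps)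
  then have "net_beta N i j * v \<le> net_beta N i j * u i j k"
    using beta by simp
  then show "net_beta N i j * u i j k = d i j k * (net_alpha N i j k
      + ln ((net_lam N i j * q i k - net_nu N k * d i j k) / (net_nu N k * d i j k)))"
    using le unfolding v L_def by simp
qed

text \<open>On the face of zero demand the cone only asks for a nonpositive reward, so optimality
  raises it to 0. This gives \<open>d * x = u\<close> also where \<open>x\<close> takes its default
  value 0.\<close>

lemma CP3_optimal_u_zero:
  assumes opt: "is_arg_max (CP3_objective N) (CP3_feasible N) (a, d, e, f, u, q)"
    and arc: "(i, j) \<in> arcs N" and k: "k \<in> {1..net_K N i}" and d: "d i j k = 0"
  shows "u i j k = 0"
proof -
  have i: "i \<in> net_zones N"
    using arc by (simp add: arcs_def)
  have z: "CP3_feasible N (a, d, e, f, u, q)"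
    using opt unfolding is_arg_max_real_iff by blast
  then have cone: "(net_lam N i j * q i k - net_nu N k * d i j k, net_nu N k * d i j k,
      net_beta N i j * net_nu N k * u i j k - net_alpha N i j k * net_nu N k * d i j k) \<in> K_exp"
    using arc k by auto
  have "u i j k \<le> 0"
    using cone d nu_pos[OF i k] arc_params_pos(3)[OF arc] by (simp add: K_exp_zero_iff mult_le_0_iff)
  moreover have "0 \<le> u i j k"
    using cone d by (intro CP3_optimal_u_ge[OF opt arc k]) (simp add: K_exp_zero_iff)
  ultimately show ?thesis
    by simp
qed

text \<open>
  The reward has infinite slope in the demand a2 demand zero: moving by a step \<open>t\<close> towards a point
  with positive demand gains of order \<open>t * ln (1 / t)\<close> there and, by convexity, loses a2 most
  order \<open>t\<close> elsewhere.
\<close>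

lemma CP3_optimal_q_zero:
  assumes opt: "is_arg_max (CP3_objective N) (CP3_feasible N) (a, d, e, f, u, q)"
    and arc: "(i, j) \<in> arcs N" and k: "k \<in> {1..net_K N i}" and d: "d i j k = 0"
  shows "q i k = 0"
proof (rule ccontr)
  assume q_ne: "q i k \<noteq> 0"
  have i: "i \<in> net_zones N"
    using arc by (simp add: arcs_def)
  note nu = nu_pos[OF i k] and pos = arc_params_pos[OF arc]
  have z: "CP3_feasible N (a, d, e, f, u, q)"
    and max: "\<And>y. CP3_feasible N y \<Longrightarrow> CP3_objective N y \<le> CP3_objective N (a, d, e, f, u, q)"
    using opt unfolding is_arg_max_real_iff by blast+
  have "q i k \<ge> 0"
    using z i k by simp
  with q_ne have "q i k > 0"
    by simp
  define c where "c = net_lam N i j * q i k"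
  have c: "c > 0"
    using \<open>q i k > 0\<close> pos by (simp add: c_def)
  obtain a1 d1 e1 f1 u1 q1 where z1: "CP3_feasible N (a1, d1, e1, f1, u1, q1)" and d1: "d1 i j k > 0"
    using exists_CP3_feasible_pos_demand[OF arc k] by blast
  define y where "y = net_nu N k * d1 i j k"
  have y: "y > 0"
    using nu d1 by (simp add: y_def)
  have "(net_lam N i j * q1 i k - y, y,
      net_beta N i j * net_nu N k * u1 i j k - net_alpha N i j k * net_nu N k * d1 i j k) \<in> K_exp"
    using z1 arc k unfolding y_def by auto
  then have w1: "net_lam N i j * q1 i k - y > 0"
    using y by (simp add: K_exp_pos_iff)
  \<comment> \<open>The slope of the objective along the segment, without the reward term of the
    entry \<open>(i, j, k)\<close>, which is replaced below.\<close>
  define \<Delta> where "\<Delta> = CP3_objective N (a1, d1, e1, f1, u1, q1) - CP3_objective N (a, d, e, f, u, q)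
    - net_nu N k * u1 i j k"
  \<comment> \<open>\<open>M\<close> will bound the log ratio in the demand cone from below. The
    first argument forces \<open>t <= 1 / 2\<close>; the second makes the total gain per unit of
    \<open>t\<close> positive.\<close>
  define M where "M = max (ln (c / y)) (1 - net_alpha N i j k - net_beta N i j * \<Delta> / y)"
  \<comment> \<open>Chosen so that \<open>exp M = (c / 2) / (t * y)\<close>, where
    \<open>c / 2\<close> bounds the unserved demand at the moved point from below.\<close>
  define t where "t = c / (2 * y) * exp (- M)"
  have t: "t > 0"
    using c y by (simp add: t_def)
  have "c / y = exp (ln (c / y))"
    using c y by simp
  also have "\<dots> \<le> exp M"
    by (simp add: M_def)
  finally have t_half: "t \<le> 1 / 2"
    using y by (simp add: t_def exp_minus field_simps)
  \<comment> \<open>The reward obtained when the log ratio is replaced by its lower bound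
    \<open>M\<close>; it therefore satisfies the cone condition.\<close>
  define v where "v = t * y * (net_alpha N i j k + M) / (net_beta N i j * net_nu N k)"
  have v: "net_beta N i j * net_nu N k * v = t * y * (net_alpha N i j k + M)"
    using nu pos by (simp add: v_def)
  define a2 where "a2 = (\<lambda>i. (1 - t) * a i + t * a1 i)"
  define d2 where "d2 = (\<lambda>i j k. (1 - t) * d i j k + t * d1 i j k)"
  define e2 where "e2 = (\<lambda>i j. (1 - t) * e i j + t * e1 i j)"
  define f2 where "f2 = (\<lambda>i j. (1 - t) * f i j + t * f1 i j)"
  define u2 where "u2 = (\<lambda>i j k. (1 - t) * u i j k + t * u1 i j k)"
  define q2 where "q2 = (\<lambda>i k. (1 - t) * q i k + t * q1 i k)"
  have zt: "CP3_feasible N (a2, d2, e2, f2, u2, q2)"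
    unfolding a2_def d2_def e2_def f2_def u2_def q2_def
    using t t_half by (intro CP3_feasible_convex z z1) auto
  have objt: "CP3_objective N (a2, d2, e2, f2, u2, q2)
    = (1 - t) * CP3_objective N (a, d, e, f, u, q) + t * CP3_objective N (a1, d1, e1, f1, u1, q1)"
    unfolding a2_def d2_def e2_def f2_def u2_def q2_def by (rule CP3_objective_affine)
  have yt: "net_nu N k * d2 i j k = t * y"
    using d by (simp add: d2_def y_def)
  have "(net_lam N i j * q2 i k - net_nu N k * d2 i j k, net_nu N k * d2 i j k,
      net_beta N i j * net_nu N k * v - net_alpha N i j k * net_nu N k * d2 i j k) \<in> K_exp"
  proof -
    define w where "w = net_lam N i j * q2 i k - t * y"
    have "w = (1 - t) * c + t * (net_lam N i j * q1 i k - y)"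
      by (simp add: w_def q2_def c_def algebra_simps)
    moreover have "(1 - t) * c \<ge> 1 / 2 * c"
      using t_half c by (intro mult_right_mono) auto
    moreover have "t * (net_lam N i j * q1 i k - y) \<ge> 0"
      using t w1 by simp
    ultimately have w: "w \<ge> c / 2"
      by simp
    have "exp M = c / 2 / (t * y)"
      using c y by (simp add: t_def exp_minus field_simps)
    also have "\<dots> \<le> w / (t * y)"
      using w t y by (intro divide_right_mono) auto
    finally have "M \<le> ln (w / (t * y))"
      using w c t y by (subst ln_ge_iff) auto
    then have "t * y * M \<le> t * y * ln (w / (t * y))"
      using t y by simp
    moreover have "net_beta N i j * net_nu N k * v - net_alpha N i j k * net_nu N k * d2 i j k = t * y * M"
    proof -
      have "net_alpha N i j k * net_nu N k * d2 i j k = net_alpha N i j k * (t * y)"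
        unfolding yt[symmetric] by simp
      then show ?thesis
        unfolding v by (simp only:) (simp add: algebra_simps)
    qed
    ultimately show ?thesis
      unfolding yt w_def[symmetric] using w c t y by (simp add: K_exp_pos_iff)
  qed
  note upd = CP3_update_u[OF zt arc k this]
  have "u2 i j k = t * u1 i j k"
    using CP3_optimal_u_zero[OF opt arc k d] by (simp add: u2_def)
  then have "(1 - t) * CP3_objective N (a, d, e, f, u, q) + t * CP3_objective N (a1, d1, e1, f1, u1, q1)
    + net_nu N k * (v - t * u1 i j k) \<le> CP3_objective N (a, d, e, f, u, q)"
    using max[OF upd(1)] unfolding upd(2) objt by simp
  then have "t * \<Delta> + net_nu N k * v \<le> 0"
    by (simp add: \<Delta>_def algebra_simps)
  moreover have "net_nu N k * v = t * (y * (net_alpha N i j k + M) / net_beta N i j)"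
    using nu pos by (simp add: v_def)
  ultimately have "t * (\<Delta> + y * (net_alpha N i j k + M) / net_beta N i j) \<le> 0"
    by (simp add: distrib_left)
  then have "\<Delta> + y * (net_alpha N i j k + M) / net_beta N i j \<le> 0"
    using t by (simp add: mult_le_0_iff)
  then have "net_beta N i j * \<Delta> / y + net_alpha N i j k + M \<le> 0"
    using y pos by (simp add: field_simps)
  moreover have "M \<ge> 1 - net_alpha N i j k - net_beta N i j * \<Delta> / y"
    by (simp add: M_def)
  ultimately show False
    by simp
qed

section \<open>Tightness of the matching constraint\<close>

text \<open>All arcs leaving \<open>i\<close> share the supply \<open>q i\<close>, so the same
  fraction \<open>t\<close> of class \<open>Suc m\<close> is moved on all of them at once. A
  nonempty destination set ensures that at least one arc gains strictly.\<close>

lemma CP3_optimal_shift: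
  assumes opt: "is_arg_max (CP3_objective N) (CP3_feasible N) (a, d, e, f, u, q)"
    and i: "i \<in> net_zones N" and dest: "net_dest N i \<noteq> {}"
    and m: "1 \<le> m" "Suc m \<le> net_K N i" and q: "q i (Suc m) > 0"
  shows "(\<Sum>k=1..m. q i k) \<ge> 1 - exp (match_exponent N a e i m)"
proof (rule ccontr)
  assume slack: "\<not> ?thesis"
  define l where "l = Suc m"
  have ml: "m \<in> {1..net_K N i}" "l \<in> {1..net_K N i}" "m \<noteq> l"
    using m by (auto simp: l_def)
  have z: "CP3_feasible N (a, d, e, f, u, q)"
    and max: "\<And>y. CP3_feasible N y \<Longrightarrow> CP3_objective N y \<le> CP3_objective N (a, d, e, f, u, q)"
    using opt unfolding is_arg_max_real_iff by blast+
  have lin: "linear_constraints N a d e f"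
    using z by simp
  have nu: "net_nu N m > 0" "net_nu N l > 0"
    using nu_pos[OF i] ml by auto
  have "1 / net_nu N m < 1 / net_nu N l"
    using m by (intro inverse_nu_less[OF i]) (auto simp: l_def)
  then have nu_less: "net_nu N l < net_nu N m"
    using nu by (simp add: field_simps)
  have d_pos: "d i j l > 0" if "j \<in> net_dest N i" for j
  proof -
    have arc: "(i, j) \<in> arcs N"
      using i that by (simp add: arcs_def)
    have "d i j l \<noteq> 0"
      using CP3_optimal_q_zero[OF opt arc ml(2)] q by (auto simp: l_def)
    moreover have "d i j l \<ge> 0"
      using linear_constraintsD(3)[OF lin arc ml(2)] .
    ultimately show ?thesis
      by simp
  qed
  define h where "h = 1 - exp (match_exponent N a e i m) - (\<Sum>k=1..m. q i k)"
  have h: "h > 0"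
    using slack by (simp add: h_def)
  \<comment> \<open>\<open>t <= 1\<close> keeps class \<open>l\<close> nonnegative, and
    \<open>t * q i l <= h\<close> fits the moved supply into the slack at \<open>m\<close>.\<close>
  define t where "t = min 1 (h / q i l)"
  have q_l: "q i l > 0"
    using q by (simp add: l_def)
  have t: "0 < t" "t \<le> 1" "t * q i l \<le> h"
  proof -
    show "0 < t" "t \<le> 1"
      using h q_l by (simp_all add: t_def)
    have "t * q i l \<le> h / q i l * q i l"
      using q_l by (intro mult_right_mono) (simp_all add: t_def)
    then show "t * q i l \<le> h"
      using q_l by simp
  qed
  \<comment> \<open>The increment of \<open>nu * u\<close> at \<open>m\<close> for which the third
    cone coordinate at \<open>m\<close> grows by exactly \<open>t\<close> times that at
    \<open>l\<close>.\<close>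
  define gain where "gain j = t * (net_nu N l * u i j l
    + (net_alpha N i j m - net_alpha N i j l) * net_nu N l * d i j l / net_beta N i j)" for j
  \<comment> \<open>Keeping the trip rate \<open>nu * d\<close> while moving to the faster class
    \<open>m\<close> frees the fraction \<open>1 - nu l / nu m\<close> of the moved pickup mass,
    which becomes idle.\<close>
  define a' where "a' v = a v
    + (if v = i then \<Sum>j\<in>net_dest N i. t * d i j l * (1 - net_nu N l / net_nu N m) else 0)" for v
  define d' where "d' v j k = d v j k + (if v = i
    then (if k = m then t * net_nu N l * d i j l / net_nu N m else 0) - (if k = l then t * d i j l else 0)
    else 0)" for v j k
  define u' where "u' v j k = u v j k + (if v = i
    then (if k = m then gain j / net_nu N m else 0) - (if k = l then t * u i j l else 0)
    else 0)" for v j k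
  define q' where "q' v k = q v k + (if v = i
    then (if k = m then t * q i l else 0) - (if k = l then t * q i l else 0)
    else 0)" for v k
  have sum2: "(\<Sum>k=1..net_K N i. g k + ((if k = m then A else 0) - (if k = l then B else 0)))
    = (\<Sum>k=1..net_K N i. g k) + (A - B)" for g :: "nat \<Rightarrow> real" and A B
    using ml by (simp add: sum.distrib sum_subtractf)
  have other: "d' v = d v" "u' v = u v" "q' v = q v" "a' v = a v" if "v \<noteq> i" for v
    using that by (simp_all add: fun_eq_iff d'_def u'_def q'_def a'_def)
  have a_le: "a v \<le> a' v" for v
    using d_pos t nu nu_less unfolding a'_def
    by (auto intro!: sum_nonneg mult_nonneg_nonneg simp: less_imp_le)
  have q'_simps: "q' i m = q i m + t * q i l" "q' i l = q i l - t * q i l"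
    using ml by (simp_all add: q'_def)
  have d'_simps: "net_nu N m * d' i j m = net_nu N m * d i j m + t * (net_nu N l * d i j l)"
    "d' i j l = (1 - t) * d i j l" for j
    using ml nu by (simp_all add: d'_def field_simps)
  have u'_simps: "net_nu N m * u' i j m = net_nu N m * u i j m + gain j"
    "u' i j l = (1 - t) * u i j l" for j
    using ml nu by (simp_all add: u'_def field_simps)
  have unchanged: "q' i k = q i k" "d' i j k = d i j k" "u' i j k = u i j k" if "k \<noteq> m" "k \<noteq> l" for j k
    using that by (simp_all add: q'_def d'_def u'_def)
  \<comment> \<open>The total trip rate of every arc is preserved, so \<open>e\<close>,
    \<open>f\<close> and the flow balance can stay as they are.\<close>
  have trips: "(\<Sum>k=1..net_K N v. net_nu N k * d' v j k) = (\<Sum>k=1..net_K N v. net_nu N k * d v j k)" for v j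
  proof (cases "v = i")
    case True
    have "(\<Sum>k=1..net_K N i. net_nu N k * d' i j k) = (\<Sum>k=1..net_K N i. net_nu N k * d i j k
      + ((if k = m then t * net_nu N l * d i j l else 0) - (if k = l then t * net_nu N l * d i j l else 0)))"
      using nu ml by (intro sum.cong) (auto simp: d'_def field_simps)
    also have "\<dots> = (\<Sum>k=1..net_K N i. net_nu N k * d i j k)"
      unfolding sum2 by simp
    finally show ?thesis
      by (simp add: True)
  qed (simp add: other)
  have mass: "a' v + (\<Sum>j\<in>net_dest_e N v. e v j)
        + (\<Sum>j\<in>net_dest N v. f v j + (\<Sum>k=1..net_K N v. d' v j k))
      = a v + (\<Sum>j\<in>net_dest_e N v. e v j)
        + (\<Sum>j\<in>net_dest N v. f v j + (\<Sum>k=1..net_K N v. d v j k))" for v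
  proof (cases "v = i")
    case True
    have "(\<Sum>k=1..net_K N i. d' i j k)
      = (\<Sum>k=1..net_K N i. d i j k) - t * d i j l * (1 - net_nu N l / net_nu N m)" for j
      unfolding d'_def if_P[OF refl] sum2 by (simp add: algebra_simps)
    then show ?thesis
      by (simp add: True a'_def sum.distrib sum_subtractf)
  qed (simp add: other)
  have "d' v j k \<ge> 0" if "(v, j) \<in> arcs N" "k \<in> {1..net_K N v}" for v j k
  proof -
    have d0: "d v j k \<ge> 0"
      using linear_constraintsD(3)[OF lin that] .
    have "d' v j k \<ge> 0" if "v = i" "k = m"
    proof -
      have "d i j l > 0"
        using d_pos \<open>(v, j) \<in> arcs N\<close> \<open>v = i\<close> by (simp add: arcs_def)
      then show ?thesis
        using that d0 t nu ml(3) by (simp add: d'_def)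
    qed
    moreover have "d' v j k \<ge> 0" if "v = i" "k = l"
      using that d0 t by (simp add: d'_simps)
    ultimately show ?thesis
      using d0 other(1)[of v] unchanged(2)[of k j] by metis
  qed
  moreover have "a' v \<ge> 0" if "v \<in> net_zones N" for v
    using a_le[of v] linear_constraintsD(2)[OF lin that] by simp
  ultimately have lin': "linear_constraints N a' d' e f"
    unfolding linear_constraints_def trips mass
    using lin[unfolded linear_constraints_def] by blast
  have q': "q' v k \<ge> 0" if "v \<in> net_zones N" "k \<in> {1..net_K N v}" for v k
  proof -
    have "q v k \<ge> 0"
      using z that by simp
    moreover have "q i l - t * q i l \<ge> 0"
      using t q_l by simp
    moreover have "t * q i l \<ge> 0"
      using t q_l by simp
    ultimately show ?thesis
      using ml(3) by (auto simp: q'_def)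
  qed
  have "exp (match_exponent N a' e v k) \<le> 1 - (\<Sum>k'=1..k. q' v k')"
    if v: "v \<in> net_zones N" and k: "k \<in> {1..net_K N v}" for v k
  proof -
    have "exp (match_exponent N a' e v k) \<le> exp (match_exponent N a e v k)"
      using match_exponent_mono_supply[where a = a and a' = a', OF v a_le] by simp
    moreover have "exp (match_exponent N a e v k) \<le> 1 - (\<Sum>k'=1..k. q' v k')"
    proof (cases "v = i")
      case True
      \<comment> \<open>The classes \<open>m\<close> and \<open>l\<close> are adjacent, so only the
        partial sum ending at \<open>m\<close> changes.\<close>
      have "(\<Sum>k'=1..k. q' i k')
        = (\<Sum>k'=1..k. q i k') + ((if m \<le> k then t * q i l else 0) - (if l \<le> k then t * q i l else 0))"
        unfolding q'_def if_P[OF refl] using m k by (auto simp: sum.distrib sum_subtractf l_def)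
      also have "\<dots> = (\<Sum>k'=1..k. q i k') + (if k = m then t * q i l else 0)"
        by (auto simp: l_def)
      finally have "(\<Sum>k'=1..k. q' i k') = (\<Sum>k'=1..k. q i k') + (if k = m then t * q i l else 0)" .
      moreover have "exp (match_exponent N a e i k) \<le> 1 - (\<Sum>k'=1..k. q i k')"
        using z v k True by (simp add: K_exp_one_iff)
      ultimately show ?thesis
        using t(3) True by (auto simp: h_def)
    next
      case False
      then show ?thesis
        using z v k by (simp add: K_exp_one_iff other)
    qed
    ultimately show ?thesis
      by linarith
  qed
  moreover have "(net_lam N v j * q' v k - net_nu N k * d' v j k, net_nu N k * d' v j k,
      net_beta N v j * net_nu N k * u' v j k - net_alpha N v j k * net_nu N k * d' v j k) \<in> K_exp"
    if arc: "(v, j) \<in> arcs N" and k: "k \<in> {1..net_K N v}" for v j k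
  proof -
    have cone: "(net_lam N v j * q v k' - net_nu N k' * d v j k', net_nu N k' * d v j k',
      net_beta N v j * net_nu N k' * u v j k' - net_alpha N v j k' * net_nu N k' * d v j k') \<in> K_exp"
      if "k' \<in> {1..net_K N v}" for k'
      using z arc that by auto
    consider "v \<noteq> i \<or> k \<noteq> m \<and> k \<noteq> l" | "v = i" "k = m" | "v = i" "k = l"
      by blast
    then show ?thesis
    proof cases
      case 1
      then have "d' v j k = d v j k" "u' v j k = u v j k" "q' v k = q v k"
        using other[of v] unchanged[of k] by (cases "v = i"; simp)+
      then show ?thesis
        using cone[OF k] by simp
    next
      \<comment> \<open>The new triple at \<open>m\<close> is the old one plus \<open>t\<close>
        times the triple at \<open>l\<close>.\<close>
      case 2
      have beta: "net_beta N i j > 0"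
        using arc_params_pos(3)[OF arc] 2 by simp
      have "net_beta N i j * net_nu N m * u' i j m - net_alpha N i j m * net_nu N m * d' i j m
        = net_beta N i j * (net_nu N m * u' i j m) - net_alpha N i j m * (net_nu N m * d' i j m)"
        by simp
      also have "\<dots> = (net_beta N i j * net_nu N m * u i j m - net_alpha N i j m * net_nu N m * d i j m)
        + t * (net_beta N i j * net_nu N l * u i j l - net_alpha N i j l * net_nu N l * d i j l)"
      proof -
        have "b * (t * (A + B / b)) = t * (b * A + B)" if "b > 0" for b A B :: real
          using that by (simp add: field_simps)
        then have "net_beta N i j * gain j = t * (net_beta N i j * (net_nu N l * u i j l)
          + (net_alpha N i j m - net_alpha N i j l) * net_nu N l * d i j l)"
          unfolding gain_def using beta by blast
        then show ?thesis
          unfolding d'_simps u'_simps distrib_left[of "net_beta N i j"] by (simp only:) (simp add: algebra_simps)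
      qed
      finally have third: "net_beta N i j * net_nu N m * u' i j m - net_alpha N i j m * net_nu N m * d' i j m
        = (net_beta N i j * net_nu N m * u i j m - net_alpha N i j m * net_nu N m * d i j m)
        + t * (net_beta N i j * net_nu N l * u i j l - net_alpha N i j l * net_nu N l * d i j l)" .
      have first: "net_lam N i j * q' i m - net_nu N m * d' i j m
        = (net_lam N i j * q i m - net_nu N m * d i j m) + t * (net_lam N i j * q i l - net_nu N l * d i j l)"
        unfolding d'_simps q'_simps by (simp add: algebra_simps)
      have cone_l: "(net_lam N i j * q i l - net_nu N l * d i j l, net_nu N l * d i j l,
        net_beta N i j * net_nu N l * u i j l - net_alpha N i j l * net_nu N l * d i j l) \<in> K_exp"
        using cone[of l] ml 2 by simp
      show ?thesis
        using K_exp_add[OF cone[OF k] K_exp_scale[OF cone_l, of t]] t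
        unfolding 2 third first unfolding d'_simps(1) by simp
    next
      \<comment> \<open>At class \<open>l\<close> the whole triple is scaled by
        \<open>1 - t\<close>.\<close>
      case 3
      then show ?thesis
        using K_exp_scale[OF cone[OF k], of "1 - t"] t
        unfolding 3 d'_simps q'_simps u'_simps by (simp add: algebra_simps)
    qed
  qed
  ultimately have z': "CP3_feasible N (a', d', e, f, u', q')"
    using lin' q' by (auto simp: K_exp_one_iff)
  define R where "R w c v j =
    (\<Sum>k=1..net_K N v. net_nu N k * w v j k - net_nu N k * net_phi N v j k * c v j k)"
    for w c :: "'z \<Rightarrow> 'z \<Rightarrow> nat \<Rightarrow> real" and v j
  have R_eq: "R u' d' v j = R u d v j" if "v \<noteq> i" for v j
    using that by (simp add: R_def other)
  have R_less: "R u d i j < R u' d' i j" if "j \<in> net_dest N i" for j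
  proof -
    have arc: "(i, j) \<in> arcs N"
      using i that by (simp add: arcs_def)
    have "R u' d' i j = (\<Sum>k=1..net_K N i. net_nu N k * u i j k - net_nu N k * net_phi N i j k * d i j k
      + ((if k = m then gain j - t * net_nu N l * d i j l * net_phi N i j m else 0)
        - (if k = l then t * net_nu N l * u i j l - t * net_nu N l * d i j l * net_phi N i j l else 0)))"
      unfolding R_def
    proof (rule sum.cong[OF refl])
      fix k
      have "net_nu N m * u' i j m - net_nu N m * net_phi N i j m * d' i j m
        = net_nu N m * u' i j m - net_phi N i j m * (net_nu N m * d' i j m)"
        by simp
      then show "net_nu N k * u' i j k - net_nu N k * net_phi N i j k * d' i j k
        = net_nu N k * u i j k - net_nu N k * net_phi N i j k * d i j k
          + ((if k = m then gain j - t * net_nu N l * d i j l * net_phi N i j m else 0)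
            - (if k = l then t * net_nu N l * u i j l - t * net_nu N l * d i j l * net_phi N i j l else 0))"
        using ml(3) unchanged[of k] unfolding d'_simps u'_simps
        by (cases "k = m"; cases "k = l") (simp_all add: d'_simps u'_simps algebra_simps)
    qed
    also have "\<dots> = R u d i j + t * (net_nu N l * d i j l)
      * ((net_alpha N i j m - net_alpha N i j l) / net_beta N i j + (net_phi N i j l - net_phi N i j m))"
      unfolding sum2 R_def gain_def by (simp add: algebra_simps)
    moreover have "(net_alpha N i j m - net_alpha N i j l) / net_beta N i j
      + (net_phi N i j l - net_phi N i j m) > 0"
      using alpha_less[OF arc m(1), of l] m arc_params_pos(3)[OF arc]
      by (intro add_pos_nonneg divide_pos_pos) (auto simp: l_def)
    ultimately show ?thesis
      using t nu d_pos[OF that] by simp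
  qed
  obtain j where j: "j \<in> net_dest N i"
    using dest by blast
  have "(\<Sum>(v, j)\<in>arcs N. R u d v j) < (\<Sum>(v, j)\<in>arcs N. R u' d' v j)"
  proof (rule sum_strict_mono_ex1[OF finite_arcs])
    show "\<forall>x\<in>arcs N. (case x of (v, j) \<Rightarrow> R u d v j) \<le> (case x of (v, j) \<Rightarrow> R u' d' v j)"
    proof (clarify)
      fix v j assume "(v, j) \<in> arcs N"
      then show "R u d v j \<le> R u' d' v j"
        using R_eq[of v j] R_less[of j] by (cases "v = i") (auto simp: arcs_def)
    qed
    show "\<exists>x\<in>arcs N. (case x of (v, j) \<Rightarrow> R u d v j) < (case x of (v, j) \<Rightarrow> R u' d' v j)"
      using R_less[OF j] i j by (intro bexI[of _ "(i, j)"]) (auto simp: arcs_def)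
  qed
  then have "CP3_objective N (a, d, e, f, u, q) < CP3_objective N (a', d', e, f, u', q')"
    by (simp add: R_def)
  then show False
    using max[OF z'] by simp
qed

lemma CP3_optimal_match_eq:
  assumes opt: "is_arg_max (CP3_objective N) (CP3_feasible N) (a, d, e, f, u, q)"
    and i: "i \<in> net_zones N" and dest: "net_dest N i \<noteq> {}" and m: "m \<in> {1..net_K N i}"
  shows "(\<Sum>k=1..m. q i k) = 1 - exp (match_exponent N a e i m)"
proof (rule ccontr)
  assume ne: "\<not> ?thesis"
  have z: "CP3_feasible N (a, d, e, f, u, q)"
    and max: "\<And>y. CP3_feasible N y \<Longrightarrow> CP3_objective N y \<le> CP3_objective N (a, d, e, f, u, q)"
    using opt unfolding is_arg_max_real_iff by blast+
  have lin: "linear_constraints N a d e f"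
    using z by simp
  define h where "h k = 1 - exp (match_exponent N a e i k) - (\<Sum>k'=1..k. q i k')" for k
  have h_nonneg: "h k \<ge> 0" if "k \<in> {1..net_K N i}" for k
  proof -
    have "exp (match_exponent N a e i k) \<le> 1 - (\<Sum>k'=1..k. q i k')"
      using z i that by (simp add: K_exp_one_iff)
    then show ?thesis
      by (simp add: h_def)
  qed
  have h_m: "h m > 0"
    using h_nonneg[OF m] ne by (simp add: h_def)
  \<comment> \<open>If slack vanished from \<open>n\<close> to \<open>Suc n\<close>, the partial sum
    would have to increase, because the exponential does not; the supply at \<open>Suc n\<close>
    would be positive and the shift would apply.\<close>
  have h_step: "h (Suc n) > 0" if "h n > 0" "m \<le> n" "Suc n \<le> net_K N i" for n
  proof (rule ccontr)
    assume "\<not> h (Suc n) > 0"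
    moreover have "exp (match_exponent N a e i (Suc n)) \<le> exp (match_exponent N a e i n)"
      using match_exponent_antimono[OF lin i, of n "Suc n"] that by simp
    ultimately have "q i (Suc n) > 0"
      using that by (simp add: h_def del: exp_le_cancel_iff)
    then have "h n \<le> 0"
      using CP3_optimal_shift[OF opt i dest, of n] that m by (simp add: h_def)
    then show False
      using that by simp
  qed
  have h_pos: "k \<le> net_K N i \<longrightarrow> h k > 0" if "m \<le> k" for k
    using that
  proof (induction k rule: dec_induct)
    case (step n)
    then show ?case
      using h_step by simp
  qed (use h_m in simp)
  \<comment> \<open>Raising \<open>q i m\<close> raises every partial sum from \<open>m\<close> on,
    so the increase is limited by the smallest of these slacks.\<close>
  define r where "r = Min (h ` {m..net_K N i})"
  have r: "r > 0" "\<And>k. k \<in> {m..net_K N i} \<Longrightarrow> r \<le> h k"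
    using h_pos m by (auto simp: r_def)
  define q' where "q' v k = q v k + (if k = m \<and> v = i then r else 0)" for v k
  have "exp (match_exponent N a e v k) \<le> 1 - (\<Sum>k'=1..k. q' v k')"
    if "v \<in> net_zones N" "k \<in> {1..net_K N v}" for v k
  proof (cases "v = i \<and> m \<le> k")
    case True
    then have "(\<Sum>k'=1..k. q' v k') = (\<Sum>k'=1..k. q i k') + r"
      using m by (simp add: q'_def sum.distrib)
    then show ?thesis
      using r(2)[of k] True that by (simp add: h_def)
  next
    case False
    then have "(\<Sum>k'=1..k. q' v k') = (\<Sum>k'=1..k. q v k')"
      by (intro sum.cong) (auto simp: q'_def)
    then show ?thesis
      using z that by (simp add: K_exp_one_iff)
  qed
  moreover have "(net_lam N v j * q' v k - net_nu N k * d v j k, net_nu N k * d v j k,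
      net_beta N v j * net_nu N k * u v j k - net_alpha N v j k * net_nu N k * d v j k) \<in> K_exp"
    if arc: "(v, j) \<in> arcs N" and k: "k \<in> {1..net_K N v}" for v j k
  proof -
    have "(net_lam N v j * q v k - net_nu N k * d v j k, net_nu N k * d v j k,
      net_beta N v j * net_nu N k * u v j k - net_alpha N v j k * net_nu N k * d v j k) \<in> K_exp"
      using z that by auto
    moreover have "net_lam N v j * (q' v k - q v k) \<ge> 0"
      using arc_params_pos(2)[OF arc] r by (simp add: q'_def)
    ultimately show ?thesis
      using K_exp_add_left[of _ _ _ "net_lam N v j * (q' v k - q v k)" 0]
      by (fastforce simp: algebra_simps)
  qed
  moreover have "q' v k \<ge> 0" if "v \<in> net_zones N" "k \<in> {1..net_K N v}" for v k
    using z that r by (simp add: q'_def)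
  ultimately have z': "CP3_feasible N (a, d, e, f, u, q')"
    using lin by (auto simp: K_exp_one_iff)
  \<comment> \<open>The objective does not involve \<open>q\<close>, so the enlarged point is optimal as well, yet it wastes supply.\<close>
  then have opt': "is_arg_max (CP3_objective N) (CP3_feasible N) (a, d, e, f, u, q')"
    using max unfolding is_arg_max_real_iff by simp
  obtain j where j: "j \<in> net_dest N i"
    using dest by blast
  have arc: "(i, j) \<in> arcs N"
    using i j by (simp add: arcs_def)
  have q'm: "q' i m = q i m + r"
    by (simp add: q'_def)
  have "q i m \<ge> 0"
    using z i m by simp
  then have "d i j m \<noteq> 0"
    using CP3_optimal_q_zero[OF opt' arc m] q'm r by auto
  moreover have "d i j m \<ge> 0"
    using linear_constraintsD(3)[OF lin arc m] .
  ultimately have d: "d i j m > 0"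
    by simp
  define y where "y = net_nu N m * d i j m"
  have y: "y > 0"
    using d nu_pos[OF i m] by (simp add: y_def)
  have w: "net_lam N i j * q i m > y" "net_lam N i j * q' i m > y"
    using CP3_optimal_u_eq(1)[OF opt arc m d] CP3_optimal_u_eq(1)[OF opt' arc m d]
    by (simp_all add: y_def)
  \<comment> \<open>Both optima have the same \<open>d\<close> and \<open>u\<close>, so equality in
    the demand cone determines the same supply for both.\<close>
  have "d i j m * (net_alpha N i j m + ln ((net_lam N i j * q i m - y) / y))
    = d i j m * (net_alpha N i j m + ln ((net_lam N i j * q' i m - y) / y))"
    using CP3_optimal_u_eq(2)[OF opt arc m d] CP3_optimal_u_eq(2)[OF opt' arc m d]
    unfolding y_def by (rule trans[OF sym])
  then have "ln ((net_lam N i j * q i m - y) / y) = ln ((net_lam N i j * q' i m - y) / y)"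
    using d by simp
  then have "net_lam N i j * q i m = net_lam N i j * q' i m"
    using w y by (simp add: ln_inj_iff)
  then show False
    using q'm r arc_params_pos(2)[OF arc] by simp
qed

end

section \<open>Transfer of the optimum from CP3 to FP3\<close>

theorem theorem6p1:
  fixes N :: "'z network"
    and a :: "'z \<Rightarrow> real"
    and e f :: "'z \<Rightarrow> 'z \<Rightarrow> real"
    and d u x p :: "'z \<Rightarrow> 'z \<Rightarrow> nat \<Rightarrow> real"
    and q :: "'z \<Rightarrow> nat \<Rightarrow> real"
  assumes network: "valid_network N"
    and optimal: "is_arg_max (CP3_objective N) (CP3_feasible N) (a, d, e, f, u, q)"
    (* If no passenger trip starts in zone i, then q i occurs in CP3 only through upper bounds on
       its partial sums, so CP3 leaves it undetermined, whereas FP3 prescribes it. *)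
    and no_dest: "\<forall>i\<in>net_zones N. net_dest N i = {} \<longrightarrow>
      (\<forall>k\<in>{1..net_K N i}. (\<Sum>k'=1..k. q i k') = 1 - exp (match_exponent N a e i k))"
    and x_def: "\<forall>(i, j)\<in>arcs N. \<forall>k\<in>{1..net_K N i}.
      x i j k = (if d i j k > 0 then u i j k / d i j k else 0)"
    and p_def: "\<forall>(i, j)\<in>arcs N. \<forall>k\<in>{1..net_K N i}.
      p i j k = exp (net_alpha N i j k - net_beta N i j * x i j k)
                / (1 + exp (net_alpha N i j k - net_beta N i j * x i j k))"
  shows "is_arg_max (FP3_objective N) (FP3_feasible N) (a, d, e, f, x, p, q)"
proof -
  have z: "CP3_feasible N (a, d, e, f, u, q)"
    and max: "\<And>y. CP3_feasible N y \<Longrightarrow> CP3_objective N y \<le> CP3_objective N (a, d, e, f, u, q)"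
    using optimal unfolding is_arg_max_real_iff by blast+
  have lin: "linear_constraints N a d e f"
    using z by simp
  have d_nonneg: "d i j k \<ge> 0" if "(i, j) \<in> arcs N" "k \<in> {1..net_K N i}" for i j k
    using linear_constraintsD(3)[OF lin that] .
  have x_eq: "x i j k = (if d i j k > 0 then u i j k / d i j k else 0)"
    if "(i, j) \<in> arcs N" "k \<in> {1..net_K N i}" for i j k
    using x_def that by blast
  have dx: "d i j k * x i j k = u i j k" if "(i, j) \<in> arcs N" "k \<in> {1..net_K N i}" for i j k
    using x_eq[OF that] d_nonneg[OF that] CP3_optimal_u_zero[OF network optimal that]
    by (cases "d i j k = 0") auto
  \<comment> \<open>Zones with a passenger destination are covered by optimality, the others by
    \<open>no_dest\<close>.\<close>
  have match: "(\<Sum>k'=1..k. q i k') = 1 - exp (match_exponent N a e i k)"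
    if "i \<in> net_zones N" "k \<in> {1..net_K N i}" for i k
    using no_dest CP3_optimal_match_eq[OF network optimal] that by blast
  have "net_lam N i j * q i k * p i j k = net_nu N k * d i j k"
    if arc: "(i, j) \<in> arcs N" and k: "k \<in> {1..net_K N i}" for i j k
  proof (cases "d i j k = 0")
    \<comment> \<open>Zero demand forces zero supply, so both sides vanish whatever \<open>p\<close>
      is.\<close>
    case True
    then show ?thesis
      using CP3_optimal_q_zero[OF network optimal arc k] by simp
  next
    case False
    then have d: "d i j k > 0"
      using d_nonneg[OF arc k] by simp
    have i: "i \<in> net_zones N"
      using arc by (simp add: arcs_def)
    define y where "y = net_nu N k * d i j k"
    define w where "w = net_lam N i j * q i k - y"
    have y: "y > 0"
      using d nu_pos[OF network i k] by (simp add: y_def)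
    have w: "w > 0"
      using CP3_optimal_u_eq(1)[OF network optimal arc k d] by (simp add: w_def y_def)
    have "d i j k * (net_beta N i j * x i j k) = net_beta N i j * u i j k"
      using dx[OF arc k] by (metis mult.left_commute)
    also have "\<dots> = d i j k * (net_alpha N i j k + ln (w / y))"
      using CP3_optimal_u_eq(2)[OF network optimal arc k d] by (simp add: w_def y_def)
    \<comment> \<open>Tightness of the demand cone inverts the logit formula: the odds of acceptance
      are the ratio of served to unserved demand.\<close>
    finally have "net_alpha N i j k - net_beta N i j * x i j k = - ln (w / y)"
      using d by simp
    then have "exp (net_alpha N i j k - net_beta N i j * x i j k) = y / w"
      using w y by (simp add: exp_minus)
    moreover have "p i j k = exp (net_alpha N i j k - net_beta N i j * x i j k)
                / (1 + exp (net_alpha N i j k - net_beta N i j * x i j k))"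
      using p_def arc k by blast
    ultimately have "p i j k = (y / w) / (1 + y / w)"
      by simp
    also have "\<dots> = y / (w + y)"
      using w by (simp add: field_simps)
    finally have "p i j k = y / (w + y)" .
    moreover have "net_lam N i j * q i k = w + y"
      by (simp add: w_def)
    ultimately show ?thesis
      using w y by (simp add: y_def)
  qed
  then have "FP3_feasible N (a, d, e, f, x, p, q)"
    unfolding FP3_feasible.simps using lin match p_def by blast
  moreover have FP_CP: "FP3_objective N (b, c, g, h, y, r, s)
    = CP3_objective N (b, c, g, h, \<lambda>i j k. c i j k * y i j k, s)" for b c g h y r s
    by (simp add: algebra_simps)
  moreover have "CP3_objective N (a, d, e, f, \<lambda>i j k. d i j k * x i j k, q)
    = CP3_objective N (a, d, e, f, u, q)"
  proof -
    have "(\<Sum>k=1..net_K N i. net_nu N k * (d i j k * x i j k) - net_nu N k * net_phi N i j k * d i j k)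
      = (\<Sum>k=1..net_K N i. net_nu N k * u i j k - net_nu N k * net_phi N i j k * d i j k)"
      if "(i, j) \<in> arcs N" for i j
      using dx[OF that] by (intro sum.cong) auto
    then show ?thesis
      unfolding CP3_objective.simps by (intro arg_cong2[where f = minus] sum.cong refl) auto
  qed
  \<comment> \<open>Every FP3 point embeds into CP3 with the same value, so the CP3 optimum bounds
    it.\<close>
  moreover have "FP3_objective N y \<le> CP3_objective N (a, d, e, f, u, q)" if y: "FP3_feasible N y" for y
  proof -
    obtain b c g h v r s where eq: "y = (b, c, g, h, v, r, s)"
      by (metis prod_cases7)
    show ?thesis
      using max[OF FP3_feasible_imp_CP3_feasible[OF network y[unfolded eq]]] unfolding eq FP_CP .
  qed
  ultimately show ?thesis
    unfolding is_arg_max_real_iff by simp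
qed

end
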